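(* Let $D\subseteq[n]\times[m]$ be a diagram whose columns are ordered by inclusion. Let $\mathscr S_D(\mathbf x;\mathbf y)$ be the lowest degree part of $\mathscr G_D(\mathbf x;\mathbf y)$. Then the polynomial $$x_1^m\cdots x_n^m\,\mathscr S_D(x_n^{-1},\dots,x_1^{-1};-1,\dots,-1)$$ is a graded nonnegative sum of Lascoux polynomials $\mathfrak L_\alpha(x_1,\dots,x_n)$, $\alpha\in\mathbb N^n$.
   Context: Notation: $[n]=\{1,\dots,n\}$, $\mathbb N=\{0,1,2,\dots\}$, $|\alpha|=\alpha_1+\dots+\alpha_n$. Operators. On polynomials in $x_1,\dots,x_n$ and variables $y_j$ ($j\in\mathbb Z$), for $i\in[n-1]$ let $s_i$ swap $x_i,x_{i+1}$ and set $\partial_i(f)=\frac{f-s_if}{x_i-x_{i+1}}$, $\overline\partial_i(f)=\partial_i((1-x_{i+1})f)$, $\overline\pi_i(f)=\overline\partial_i(x_if)$, and $\overline\pi_{i,j}(f)=\overline\partial_i((x_i+y_j-x_iy_j)f)$. For $i\in[n]$ and a finite set $M$ of positive integers, $\overline\omega_i^M=\prod_{a\in[i],\,m\in M}(x_a+y_m-x_ay_m)$. Diagrams. A diagram is a subset $D\subseteq[n]\times[m]$, identified with its columns $(D_1,\dots,D_m)$, $D_j=\{i\in[n]:(i,j)\in D\}$. Its columns are ordered by inclusion if for all $j,j'$ either $D_j\subseteq D_{j'}$ or $D_{j'}\subseteq D_j$. $D$ is \%-avoiding if whenever $i_1<i_2$, $j_1<j_2$, $i_2\in D_{j_1}$ and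 $i_1\in D_{j_2}$, then $i_1\in D_{j_1}$ or $i_2\in D_{j_2}$; a diagram whose columns are ordered by inclusion is \%-avoiding. Double orthodontic sequence of a \%-avoiding diagram $D$. Set $K_i=\{j: D_j=[i]\}$ for $i\in[n]$, and let $D_-$ be $D$ with all these columns replaced by empty columns. A missing tooth of a column $C\subseteq[n]$ is $i\in[n-1]$ with $i\notin C$, $i+1\in C$. If the current diagram $E$ (initially $E=D_-$) is nonempty, perform the $k$-th orthodontic step ($k=1,2,\dots$): let $E_j$ be the leftmost nonempty column of $E$, let $i_k$ be its smallest missing tooth, and let $j_k=j-\#\{a\le i_k: a\notin E_j\}$ (which may be $\le 0$); swap rows $i_k$ and $i_k+1$ of $E$ to get $E'$; let $M_k=\{j:E'_j=[i_k]\}$; let $E''$ be $E'$ with the columns equal to $[i_k]$ replaced by empty columns, and continue with $E''$. Stop when the diagram is empty (this always happens after finitely many steps); $\ell$ is the number of steps. Then $$\mathscr G_D(\mathbf x;\mathbf y)=\overline\omega_1^{K_1}\cdots\overline\omega_n^{K_n}\,\overline\pi_{i_1,j_1}\bigl(\overline\omega_{i_1}^{M_1}\,\overline\pi_{i_2,j_2}(\overline\omega_{i_2}^{M_2}\cdots\overline\pi_{i_\ell,j_\ell}(\overline\omega_{i_\ell}^{M_\ell})\cdots)\bigr).$$ Lowest degree part is taken with respect to total degree in all $x$- and $y$-variables. In the specialization, every $y$-variable (including those with nonpositive index) is set to $-1$. Lascoux polynomials. For $\alpha\in\mathbb N^n$, $\mathfrak L_\alpha=x_1^{\alpha_1}\cdots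 x_n^{\alpha_n}$ if $\alpha_1\ge\dots\ge\alpha_n$, and $\mathfrak L_\alpha=\overline\pi_i\mathfrak L_{\alpha\cdot s_i}$ if $\alpha_i<\alpha_{i+1}$, where $\alpha\cdot s_i$ is $\alpha$ with entries $i,i+1$ swapped. A nonzero polynomial $f$ is a graded nonnegative sum of Lascoux polynomials if $f=\sum_\alpha(-1)^{|\alpha|-d}c_\alpha\mathfrak L_\alpha$ (a finite sum) with all $c_\alpha\ge0$, where $d$ is the lowest total degree of a term of $f$. *)

theory Defs
  imports
    Complex_Main
    "HOL-Library.Poly_Mapping"
    "HOL-Library.FuncSet"
    "HOL-Combinatorics.Transposition"
begin

section \<open>Polynomials in the variables $x_i$ and $y_j$\<close>

text \<open>
  The indices of the \<open>y\<close>-variables range over all integers. Monomials are finitely supported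
  exponent vectors, and a polynomial is a finitely supported family of integer coefficients
  indexed by the monomials.
\<close>

datatype var = XVar nat | YVar int

type_synonym pol = "(var \<Rightarrow>\<^sub>0 nat) \<Rightarrow>\<^sub>0 int"

definition pvar :: "var \<Rightarrow> pol" where
  "pvar v = Poly_Mapping.single (Poly_Mapping.single v 1) 1"

abbreviation xv :: "nat \<Rightarrow> pol" where "xv i \<equiv> pvar (XVar i)"
abbreviation yv :: "int \<Rightarrow> pol" where "yv j \<equiv> pvar (YVar j)"

text \<open>Substitution: the ring homomorphism that sends each variable \<open>v\<close> to \<open>h v\<close>.\<close>

definition subst_pol :: "(var \<Rightarrow> 'r::comm_ring_1) \<Rightarrow> pol \<Rightarrow> 'r" where
  "subst_pol h p =
    (\<Sum>t\<in>Poly_Mapping.keys p. of_int (Poly_Mapping.lookup p t) *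
       (\<Prod>v\<in>Poly_Mapping.keys t. h v ^ Poly_Mapping.lookup t v))"

definition tdeg :: "(var \<Rightarrow>\<^sub>0 nat) \<Rightarrow> nat" where
  "tdeg t = (\<Sum>v\<in>Poly_Mapping.keys t. Poly_Mapping.lookup t v)"

text \<open>The following two are only meaningful for nonzero polynomials.\<close>

definition low_deg :: "pol \<Rightarrow> nat" where
  "low_deg p = Min (tdeg ` Poly_Mapping.keys p)"

definition lowest_part :: "pol \<Rightarrow> pol" where
  "lowest_part p =
    (\<Sum>t\<in>{t \<in> Poly_Mapping.keys p. tdeg t = low_deg p}.
       Poly_Mapping.single t (Poly_Mapping.lookup p t))"

section \<open>Operators\<close>

definition swap_vars :: "nat \<Rightarrow> pol \<Rightarrow> pol" where
  "swap_vars i = subst_pol (\<lambda>v. case v of XVar a \<Rightarrow> xv (transpose i (Suc i) a) | YVar j \<Rightarrow> yv j)"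

text \<open>The quotient exists, and it is unique because \<open>pol\<close> has no zero divisors.\<close>

definition ddiff :: "nat \<Rightarrow> pol \<Rightarrow> pol" where
  "ddiff i f = (THE g. (xv i - xv (Suc i)) * g = f - swap_vars i f)"

definition ddiff_bar :: "nat \<Rightarrow> pol \<Rightarrow> pol" where
  "ddiff_bar i f = ddiff i ((1 - xv (Suc i)) * f)"

definition pi_bar :: "nat \<Rightarrow> pol \<Rightarrow> pol" where
  "pi_bar i f = ddiff_bar i (xv i * f)"

definition pi_bar2 :: "nat \<Rightarrow> int \<Rightarrow> pol \<Rightarrow> pol" where
  "pi_bar2 i j f = ddiff_bar i ((xv i + yv j - xv i * yv j) * f)"

definition omega_bar :: "nat \<Rightarrow> nat set \<Rightarrow> pol" where
  "omega_bar i M = (\<Prod>a\<in>{1..i}. \<Prod>m\<in>M. xv a + yv (int m) - xv a * yv (int m))"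

section \<open>Diagrams and double orthodontia\<close>

text \<open>The box \<open>(i, j)\<close> of a diagram lies in row \<open>i\<close> and column \<open>j\<close>; both are counted from 1.\<close>

type_synonym diagram = "(nat \<times> nat) set"

definition col :: "diagram \<Rightarrow> nat \<Rightarrow> nat set" where
  "col D j = {i. (i, j) \<in> D}"

definition columns_ordered_by_inclusion :: "nat \<Rightarrow> diagram \<Rightarrow> bool" where
  "columns_ordered_by_inclusion m D \<longleftrightarrow>
     (\<forall>j\<in>{1..m}. \<forall>j'\<in>{1..m}. col D j \<subseteq> col D j' \<or> col D j' \<subseteq> col D j)"

definition interval_cols :: "nat \<Rightarrow> diagram \<Rightarrow> nat set" where
  "interval_cols i D = {j. col D j = {1..i}}"

definition empty_cols :: "nat set \<Rightarrow> diagram \<Rightarrow> diagram" where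
  "empty_cols J D = {(i, j) \<in> D. j \<notin> J}"

definition swap_rows :: "nat \<Rightarrow> diagram \<Rightarrow> diagram" where
  "swap_rows i D = (\<lambda>(a, j). (transpose i (Suc i) a, j)) ` D"

text \<open>For \<open>C \<subseteq> {1..n}\<close>, every missing tooth is automatically less than \<open>n\<close>.\<close>

definition missing_tooth :: "nat set \<Rightarrow> nat \<Rightarrow> bool" where
  "missing_tooth C i \<longleftrightarrow> 1 \<le> i \<and> i \<notin> C \<and> Suc i \<in> C"

definition first_col :: "diagram \<Rightarrow> nat" where
  "first_col E = (LEAST j. col E j \<noteq> {})"

definition tooth :: "diagram \<Rightarrow> nat" where
  "tooth E = (LEAST i. missing_tooth (col E (first_col E)) i)"

definition tooth_index :: "diagram \<Rightarrow> int" where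
  "tooth_index E =
     int (first_col E) - int (card {a \<in> {1..tooth E}. a \<notin> col E (first_col E)})"

definition tooth_cols :: "diagram \<Rightarrow> nat set" where
  "tooth_cols E = interval_cols (tooth E) (swap_rows (tooth E) E)"

definition ortho_step :: "diagram \<Rightarrow> diagram" where
  "ortho_step E = empty_cols (tooth_cols E) (swap_rows (tooth E) E)"

text \<open>
  \<open>ortho_diagram n D k\<close> is the diagram after \<open>k\<close> steps, so the data of step \<open>k + 1\<close> are
  \<open>tooth\<close>, \<open>tooth_index\<close> and \<open>tooth_cols\<close> of \<open>ortho_diagram n D k\<close>.
\<close>

definition ortho_start :: "nat \<Rightarrow> diagram \<Rightarrow> diagram" where
  "ortho_start n D = empty_cols (\<Union>i\<in>{1..n}. interval_cols i D) D"

definition ortho_diagram :: "nat \<Rightarrow> diagram \<Rightarrow> nat \<Rightarrow> diagram" where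
  "ortho_diagram n D k = (ortho_step ^^ k) (ortho_start n D)"

definition ortho_length :: "nat \<Rightarrow> diagram \<Rightarrow> nat" where
  "ortho_length n D = (LEAST k. ortho_diagram n D k = {})"

definition double_G :: "nat \<Rightarrow> diagram \<Rightarrow> pol" where
  "double_G n D =
     (\<Prod>i\<in>{1..n}. omega_bar i (interval_cols i D)) *
     foldr
       (\<lambda>k f. let E = ortho_diagram n D k
               in pi_bar2 (tooth E) (tooth_index E) (omega_bar (tooth E) (tooth_cols E) * f))
       [0..<ortho_length n D] 1"

definition double_S :: "nat \<Rightarrow> diagram \<Rightarrow> pol" where
  "double_S n D = lowest_part (double_G n D)"

section \<open>Lascoux polynomials\<close>

text \<open>
  A weak composition with \<open>n\<close> parts is an element of \<open>{1..n} \<rightarrow>\<^sub>E UNIV\<close>. Among the ascents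
  \<open>\<alpha> i < \<alpha> (i + 1)\<close>, the recursion uses the first one; since the operators \<open>pi_bar i\<close>
  satisfy the braid and commutation relations, any other choice gives the same polynomial.
\<close>

definition compositions :: "nat \<Rightarrow> (nat \<Rightarrow> nat) set" where
  "compositions n = {1..n} \<rightarrow>\<^sub>E UNIV"

definition ascent :: "nat \<Rightarrow> (nat \<Rightarrow> nat) \<Rightarrow> nat \<Rightarrow> bool" where
  "ascent n \<alpha> i \<longleftrightarrow> 1 \<le> i \<and> i < n \<and> \<alpha> i < \<alpha> (Suc i)"

function lascoux :: "nat \<Rightarrow> (nat \<Rightarrow> nat) \<Rightarrow> pol" where
  "lascoux n \<alpha> =
     (if \<exists>i. ascent n \<alpha> i
      then let i = (LEAST i. ascent n \<alpha> i) in pi_bar i (lascoux n (\<alpha> \<circ> transpose i (Suc i)))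
      else (\<Prod>i\<in>{1..n}. xv i ^ \<alpha> i))"
  by pat_completeness auto

lemma weight_swap_less:
  assumes "ascent n \<alpha> i"
  shows "(\<Sum>a\<in>{1..n}. a * (\<alpha> \<circ> transpose i (Suc i)) a) < (\<Sum>a\<in>{1..n}. a * \<alpha> a)"
proof -
  have i: "1 \<le> i" "i < n" "\<alpha> i < \<alpha> (Suc i)" using assms by (auto simp: ascent_def)
  let ?R = "{1..n} - {i, Suc i}"
  have split: "(\<Sum>a\<in>{1..n}. g a) = g i + g (Suc i) + (\<Sum>a\<in>?R. g a)" for g :: "nat \<Rightarrow> nat"
  proof -
    have "{1..n} = {i, Suc i} \<union> ?R" using i by auto
    then have "(\<Sum>a\<in>{1..n}. g a) = (\<Sum>a\<in>{i, Suc i}. g a) + (\<Sum>a\<in>?R. g a)"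
      by (metis Diff_disjoint finite.emptyI finite.insertI finite_Diff finite_atLeastAtMost
          sum.union_disjoint)
    then show ?thesis by simp
  qed
  have "(\<Sum>a\<in>?R. a * (\<alpha> \<circ> transpose i (Suc i)) a) = (\<Sum>a\<in>?R. a * \<alpha> a)"
    by (intro sum.cong) auto
  then show ?thesis using i by (simp only: split) (simp add: algebra_simps)
qed

termination lascoux
proof (relation "measure (\<lambda>(n, \<alpha>). \<Sum>a\<in>{1..n}. a * \<alpha> a)")
  fix n i :: nat and \<alpha> :: "nat \<Rightarrow> nat"
  assume "\<exists>i. ascent n \<alpha> i" and "i = (LEAST i. ascent n \<alpha> i)"
  then have "ascent n \<alpha> i" by (metis LeastI)
  then show "((n, \<alpha> \<circ> transpose i (Suc i)), (n, \<alpha>)) \<in> measure (\<lambda>(n, \<alpha>). \<Sum>a\<in>{1..n}. a * \<alpha> a)"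
    using weight_swap_less by simp
qed simp

declare lascoux.simps [simp del]

definition size_comp :: "nat \<Rightarrow> (nat \<Rightarrow> nat) \<Rightarrow> nat" where
  "size_comp n \<alpha> = (\<Sum>i\<in>{1..n}. \<alpha> i)"

text \<open>
  The sign \<open>(-1)^(|\<alpha>| - d)\<close> is written \<open>(-1)^(|\<alpha>| + d)\<close> to avoid truncated subtraction.
\<close>

definition graded_nonneg_lascoux :: "nat \<Rightarrow> pol \<Rightarrow> bool" where
  "graded_nonneg_lascoux n f \<longleftrightarrow>
     f \<noteq> 0 \<and>
     (\<exists>A c. finite A \<and> A \<subseteq> compositions n \<and> (\<forall>\<alpha>\<in>A. 0 \<le> (c \<alpha> :: int)) \<and>
       f = (\<Sum>\<alpha>\<in>A. (-1) ^ (size_comp n \<alpha> + low_deg f) * of_int (c \<alpha>) * lascoux n \<alpha>))"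

section \<open>Laurent polynomials and the specialization\<close>

type_synonym laurent = "(var \<Rightarrow>\<^sub>0 int) \<Rightarrow>\<^sub>0 int"

definition LVar :: "var \<Rightarrow> int \<Rightarrow> laurent" where
  "LVar v e = Poly_Mapping.single (Poly_Mapping.single v e) 1"

definition to_laurent :: "pol \<Rightarrow> laurent" where
  "to_laurent = subst_pol (\<lambda>v. LVar v 1)"

text \<open>Substitute \<open>x\<^sub>i \<mapsto> x\<^bsub>n+1-i\<^esub>\<^sup>-\<^sup>1\<close> for \<open>1 \<le> i \<le> n\<close>, and \<open>y\<^sub>j \<mapsto> -1\<close>.\<close>

definition reverse_inverse_spec :: "nat \<Rightarrow> pol \<Rightarrow> laurent" where
  "reverse_inverse_spec n =
    subst_pol (\<lambda>v. case v of XVar i \<Rightarrow> LVar (XVar (n + 1 - i)) (-1) | YVar j \<Rightarrow> -1)"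

end

theory Submission
  imports Defs "HOL-Combinatorics.Permutations"
begin

text \<open>
  Write $z_i = x_i - 1$. After the specialization $y_j = -1$, the lowest degree part of
  $\overline\pi_{i,j}$ becomes $f \mapsto \partial_i(z_i f)$, an ordinary Demazure operator in the
  variables $z$, and the factor of a column $[i]$ becomes $z_1 \cdots z_i$. For nested columns the
  orthodontic sequence therefore computes the key polynomial, in $z$, of the row sizes of $D$.
  The substitution $x_i \mapsto x_{n+1-i}^{-1}$ turns $f \mapsto \partial_i(z_i f)$ exactly into
  $\overline\pi_{n-i}$, and, multiplied by $x_1 \cdots x_n$, the factor of a column $[i]$ into
  \[ P_k = x_1 \cdots x_k (1 - x_{k+1}) \cdots (1 - x_n), \qquad k = n - i. \]

  Hence the polynomial in question arises from a seed
  $\prod_a x_a^{\nu_a} (1 - x_a)^{m - \nu_a}$, with $\nu$ weakly decreasing, by operators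
  $\overline\pi_i$ (the relation \<open>seed_orbit\<close>). Nestedness enters twice: a missing tooth $i$ makes row
  $i$ a proper subset of row $i + 1$, so that each $\overline\pi_{n-i}$ is applied at an ascent; and a
  column $[i]$ splits the rows into larger and smaller ones, so that $P_{n-i}$ commutes with all
  operators applied so far and can be absorbed into the seed
  (\<open>seed_orbit_column_factor\<close>, \<open>realizes_pi_bar2\<close>, \<open>realizes_omega_bar\<close>).

  Graded nonnegativity is preserved by $\overline\pi_i$, because $\overline\pi_i$ maps every Lascoux
  polynomial to a Lascoux polynomial of the same size; this rests on the braid relations. It remains
  to treat the seeds. A seed is a product of factors $P_k$, and multiplying by them in the order of
  decreasing $k$ preserves nonnegativity (\<open>graded_cone_column_factor\<close>). The computation behind
  this is that of $x^\kappa \prod_{a > k} (1 - x_a)$ for a partition $\kappa$: on a block of equal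
  entries of $\kappa$, the product of the $1 - x_a$ arises from its first factor by operators
  $\overline\pi_i$ (\<open>graded_cone_monomial_times_tail\<close>).

  The signs refer to the lowest degree, so this degree has to be known. The lowest degree part of an
  orbit element is obtained from $x^\nu$ by Demazure operators, and it is nonzero because these
  operators do not change the antisymmetrization of $x_1^{n-1} \cdots x_n^0 f$, which for
  $f = x^\nu$ is a nonzero alternant (\<open>seed_orbit_lowest_part\<close>). The same fact shows that the formal
  lowest degree part of $\mathscr G_D$ does not vanish, hence that it is $\mathscr S_D$.
\<close>

section \<open>The ring of polynomials\<close>

text \<open>
  A linear order on the variables induces a monomial order, and leading monomials show that
  polynomials and Laurent polynomials form integral domains. The chosen order is arbitrary.
\<close>

instantiation var :: linorder
begin

definition less_eq_var :: "var \<Rightarrow> var \<Rightarrow> bool" where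
  "v \<le> w \<longleftrightarrow> (case v of
      XVar a \<Rightarrow> (case w of XVar b \<Rightarrow> a \<le> b | YVar _ \<Rightarrow> True)
    | YVar a \<Rightarrow> (case w of XVar _ \<Rightarrow> False | YVar b \<Rightarrow> a \<le> b))"

definition less_var :: "var \<Rightarrow> var \<Rightarrow> bool" where
  "(v::var) < w \<longleftrightarrow> v \<le> w \<and> \<not> w \<le> v"

instance
  by standard (auto simp: less_eq_var_def less_var_def split: var.splits)

end

locale ring_map =
  fixes \<phi> :: "'a::comm_ring_1 \<Rightarrow> 'b::comm_ring_1"
  assumes map_one: "\<phi> 1 = 1"
    and map_add: "\<phi> (p + q) = \<phi> p + \<phi> q"
    and map_mult: "\<phi> (p * q) = \<phi> p * \<phi> q"
begin

lemma map_zero: "\<phi> 0 = 0"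
  using map_add[of 0 0] by simp

lemma map_uminus: "\<phi> (- p) = - \<phi> p"
  using map_add[of p "- p"] map_zero by (simp add: eq_neg_iff_add_eq_0 add.commute)

lemma map_diff: "\<phi> (p - q) = \<phi> p - \<phi> q"
  using map_add[of p "- q"] map_uminus by simp

lemma map_power: "\<phi> (p ^ k) = \<phi> p ^ k"
  by (induction k) (simp_all add: map_one map_mult)

lemma map_prod: "\<phi> (\<Prod>x\<in>X. f x) = (\<Prod>x\<in>X. \<phi> (f x))"
  by (induction X rule: infinite_finite_induct) (simp_all add: map_one map_mult)

lemmas map_simps = map_one map_zero map_add map_mult map_uminus map_diff map_power map_prod

end

lemma ring_map_comp:
  assumes "ring_map \<phi>" "ring_map \<psi>"
  shows "ring_map (\<lambda>p. \<psi> (\<phi> p))"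
proof -
  interpret f: ring_map \<phi> by fact
  interpret g: ring_map \<psi> by fact
  show ?thesis by unfold_locales (simp_all add: f.map_simps g.map_simps)
qed

subsection \<open>Extending a map on monomials linearly\<close>

text \<open>
  A homomorphism from the monoid of exponents to the multiplicative monoid of a ring extends to a ring
  homomorphism. Substitution into a polynomial and the exchange of two variables in a Laurent
  polynomial, where the exponents may be negative, are both of this form.
\<close>

definition monomial_ext :: "('k \<Rightarrow> 'r::comm_ring_1) \<Rightarrow> ('k \<Rightarrow>\<^sub>0 int) \<Rightarrow> 'r" where
  "monomial_ext M p = (\<Sum>t\<in>Poly_Mapping.keys p. of_int (Poly_Mapping.lookup p t) * M t)"

lemma monomial_ext_superset:
  assumes "finite F" "Poly_Mapping.keys p \<subseteq> F"
  shows "monomial_ext M p = (\<Sum>t\<in>F. of_int (Poly_Mapping.lookup p t) * M t)"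
  unfolding monomial_ext_def using assms
  by (intro sum.mono_neutral_left) (auto simp: in_keys_iff)

lemma monomial_ext_add: "monomial_ext M (p + q) = monomial_ext M p + monomial_ext M q"
proof -
  let ?F = "Poly_Mapping.keys p \<union> Poly_Mapping.keys q"
  have "monomial_ext M (p + q) = (\<Sum>t\<in>?F. of_int (Poly_Mapping.lookup (p + q) t) * M t)"
    using keys_add[of p q] by (intro monomial_ext_superset) auto
  then show ?thesis
    by (simp add: monomial_ext_superset[of ?F] lookup_add distrib_right sum.distrib)
qed

lemma monomial_ext_diff: "monomial_ext M (p - q) = monomial_ext M p - monomial_ext M q"
  using monomial_ext_add[of M "p - q" q] by simp

lemma monomial_ext_zero [simp]: "monomial_ext M 0 = 0"
  by (simp add: monomial_ext_def)

lemma monomial_ext_single: "monomial_ext M (Poly_Mapping.single t c) = of_int c * M t"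
  by (simp add: monomial_ext_def)

lemma mapping_induct [case_names zero monomial diff]:
  fixes p :: "'k \<Rightarrow>\<^sub>0 int"
  assumes "P 0" "\<And>t. P (Poly_Mapping.single t 1)" "\<And>p q. P p \<Longrightarrow> P q \<Longrightarrow> P (p - q)"
  shows "P p"
  by (rule frag_induction[where S = UNIV]) (use assms in auto)

lemma ring_map_monomial_ext:
  fixes M :: "'k::comm_monoid_add \<Rightarrow> 'r::comm_ring_1"
  assumes "M 0 = 1" "\<And>s t. M (s + t) = M s * M t"
  shows "ring_map (monomial_ext M)"
proof
  show "monomial_ext M 1 = 1"
    using monomial_ext_single[of M 0 1] assms by simp
  fix p q
  show "monomial_ext M (p + q) = monomial_ext M p + monomial_ext M q"
    by (rule monomial_ext_add)
  have mono: "monomial_ext M (Poly_Mapping.single s 1 * q) = M s * monomial_ext M q" for s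
    by (induction q rule: mapping_induct)
      (simp_all add: mult_single monomial_ext_single assms right_diff_distrib monomial_ext_diff)
  show "monomial_ext M (p * q) = monomial_ext M p * monomial_ext M q"
    by (induction p rule: mapping_induct)
      (simp_all add: mono monomial_ext_single left_diff_distrib monomial_ext_diff)
qed

lemma subst_pol_conv_monomial_ext:
  "subst_pol h = monomial_ext (\<lambda>t. \<Prod>v\<in>Poly_Mapping.keys t. h v ^ Poly_Mapping.lookup t v)"
  by (rule ext) (simp add: subst_pol_def monomial_ext_def)

lemma prod_keys_superset:
  fixes h :: "'v \<Rightarrow> 'r::comm_ring_1" and t :: "'v \<Rightarrow>\<^sub>0 nat"
  assumes "finite F" "Poly_Mapping.keys t \<subseteq> F"
  shows "(\<Prod>v\<in>Poly_Mapping.keys t. h v ^ Poly_Mapping.lookup t v) =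
    (\<Prod>v\<in>F. h v ^ Poly_Mapping.lookup t v)"
  using assms by (intro prod.mono_neutral_left) (auto simp: in_keys_iff)

lemma ring_map_subst_pol: "ring_map (subst_pol h)"
  unfolding subst_pol_conv_monomial_ext
proof (rule ring_map_monomial_ext)
  fix s t :: "var \<Rightarrow>\<^sub>0 nat"
  let ?F = "Poly_Mapping.keys s \<union> Poly_Mapping.keys t"
  have "Poly_Mapping.keys (s + t) \<subseteq> ?F" by (rule keys_add)
  then have "(\<Prod>v\<in>Poly_Mapping.keys (s + t). h v ^ Poly_Mapping.lookup (s + t) v) =
    (\<Prod>v\<in>?F. h v ^ Poly_Mapping.lookup (s + t) v)"
    by (intro prod_keys_superset) auto
  moreover have "(\<Prod>v\<in>Poly_Mapping.keys s. h v ^ Poly_Mapping.lookup s v) =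
    (\<Prod>v\<in>?F. h v ^ Poly_Mapping.lookup s v)"
    by (intro prod_keys_superset) auto
  moreover have "(\<Prod>v\<in>Poly_Mapping.keys t. h v ^ Poly_Mapping.lookup t v) =
    (\<Prod>v\<in>?F. h v ^ Poly_Mapping.lookup t v)"
    by (intro prod_keys_superset) auto
  ultimately show "(\<Prod>v\<in>Poly_Mapping.keys (s + t). h v ^ Poly_Mapping.lookup (s + t) v) =
    (\<Prod>v\<in>Poly_Mapping.keys s. h v ^ Poly_Mapping.lookup s v) *
    (\<Prod>v\<in>Poly_Mapping.keys t. h v ^ Poly_Mapping.lookup t v)"
    by (simp add: lookup_add power_add prod.distrib)
qed simp

lemma subst_pol_pvar [simp]: "subst_pol h (pvar v) = h v"
  by (simp add: pvar_def subst_pol_conv_monomial_ext monomial_ext_single)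

lemma single_add_exponents:
  "Poly_Mapping.single (s + t) (1::int) = Poly_Mapping.single s 1 * Poly_Mapping.single t 1"
  by (simp add: mult_single)

lemma single_sum_exponents:
  fixes f :: "'i \<Rightarrow> 'k::comm_monoid_add"
  shows "Poly_Mapping.single (\<Sum>i\<in>I. f i) (1::int) = (\<Prod>i\<in>I. Poly_Mapping.single (f i) 1)"
  by (induction I rule: infinite_finite_induct) (simp_all add: single_add_exponents)

lemma sum_keys_single:
  "(\<Sum>v\<in>Poly_Mapping.keys t. Poly_Mapping.single v (Poly_Mapping.lookup t v)) = t"
  by (rule poly_mapping_eqI) (auto simp: lookup_sum lookup_single when_def in_keys_iff)

lemma pvar_power: "pvar v ^ k = Poly_Mapping.single (Poly_Mapping.single v k) 1"
  by (induction k) (simp_all add: pvar_def mult_single flip: single_add)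

lemma monomial_eq_prod:
  "Poly_Mapping.single t 1 = (\<Prod>v\<in>Poly_Mapping.keys t. pvar v ^ Poly_Mapping.lookup t v)"
  unfolding pvar_power by (simp add: sum_keys_single flip: single_sum_exponents)

lemma pol_induct [case_names one var diff mult]:
  assumes one: "P 1" and var: "\<And>v. P (pvar v)"
    and diff: "\<And>p q. P p \<Longrightarrow> P q \<Longrightarrow> P (p - q)" and mult: "\<And>p q. P p \<Longrightarrow> P q \<Longrightarrow> P (p * q)"
  shows "P (p :: pol)"
proof (induction p rule: mapping_induct)
  case zero
  show ?case using diff[OF one one] by simp
next
  case (monomial t)
  have pow: "P (pvar v ^ k)" for v k
    by (induction k) (auto intro: assms)
  have "P (\<Prod>v\<in>V. pvar v ^ e v)" for V e
    by (induction V rule: infinite_finite_induct) (auto intro: assms pow)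
  then show ?case by (simp add: monomial_eq_prod)
qed (rule diff)

text \<open>
  Identities between substitutions are all proved by this principle: it suffices to compare the
  values at the variables.
\<close>

lemma ring_map_unique:
  assumes "ring_map \<phi>" "ring_map \<psi>" "\<And>v. \<phi> (pvar v) = \<psi> (pvar v)"
  shows "\<phi> (p :: pol) = \<psi> p"
proof -
  interpret f: ring_map \<phi> by fact
  interpret g: ring_map \<psi> by fact
  show ?thesis
    by (induction p rule: pol_induct) (simp_all add: assms(3) f.map_simps g.map_simps)
qed

lemma pvar_inject [simp]: "pvar v = pvar w \<longleftrightarrow> v = w"
proof -
  have "Poly_Mapping.single v (1::nat) = Poly_Mapping.single w 1 \<Longrightarrow> v = w"
    by (metis keys_single one_neq_zero singleton_inject)
  then show ?thesis by (auto simp: pvar_def frag_of_eq)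
qed

section \<open>Swaps and divided differences\<close>

interpretation swap: ring_map "swap_vars i" for i
  unfolding swap_vars_def by (rule ring_map_subst_pol)

lemma swap_vars_xv [simp]: "swap_vars i (xv a) = xv (transpose i (Suc i) a)"
  by (simp add: swap_vars_def)

lemma swap_vars_yv [simp]: "swap_vars i (yv j) = yv j"
  by (simp add: swap_vars_def)

lemma swap_vars_swap_vars [simp]: "swap_vars i (swap_vars i f) = f"
proof (rule ring_map_unique[of "\<lambda>f. swap_vars i (swap_vars i f)" "\<lambda>f. f"])
  show "ring_map (\<lambda>f. swap_vars i (swap_vars i f))"
    by (rule ring_map_comp[OF swap.ring_map_axioms swap.ring_map_axioms])
  show "ring_map (\<lambda>f::pol. f)" by unfold_locales simp_all
  show "swap_vars i (swap_vars i (pvar v)) = pvar v" for v by (cases v) simp_all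
qed

lemma ddiff_exists: "\<exists>g. (xv i - xv (Suc i)) * g = f - swap_vars i f"
proof (induction f rule: pol_induct)
  case one
  show ?case by (intro exI[of _ 0]) (simp add: swap.map_simps)
next
  case (var v)
  show ?case
  proof (cases v)
    case (XVar a)
    consider "a = i" | "a = Suc i" | "a \<noteq> i" "a \<noteq> Suc i" by blast
    then show ?thesis
    proof cases
      case 1
      then show ?thesis using XVar by (intro exI[of _ 1]) simp
    next
      case 2
      then show ?thesis using XVar by (intro exI[of _ "-1"]) simp
    next
      case 3
      then show ?thesis using XVar by (intro exI[of _ 0]) simp
    qed
  next
    case (YVar j)
    then show ?thesis by (intro exI[of _ 0]) simp
  qed
next
  case (diff p q)
  then obtain g h where gh: "(xv i - xv (Suc i)) * g = p - swap_vars i p"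
    "(xv i - xv (Suc i)) * h = q - swap_vars i q" by blast
  show ?case
    by (intro exI[of _ "g - h"]) (simp add: swap.map_simps right_diff_distrib[of _ g h] gh)
next
  case (mult p q)
  then obtain g h where gh: "(xv i - xv (Suc i)) * g = p - swap_vars i p"
    "(xv i - xv (Suc i)) * h = q - swap_vars i q" by blast
  \<comment> \<open>the twisted Leibniz rule for divided differences\<close>
  have "(xv i - xv (Suc i)) * (g * q + swap_vars i p * h) =
      ((xv i - xv (Suc i)) * g) * q + swap_vars i p * ((xv i - xv (Suc i)) * h)"
    by (simp add: algebra_simps)
  also have "\<dots> = p * q - swap_vars i (p * q)"
    unfolding gh by (simp add: swap.map_simps algebra_simps)
  finally show ?case by blast
qed

lemma xv_diff_nonzero: "a \<noteq> b \<Longrightarrow> xv a - xv b \<noteq> 0"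
  by simp

lemma ddiff_eq: "(xv i - xv (Suc i)) * ddiff i f = f - swap_vars i f"
proof -
  have "\<exists>!g. (xv i - xv (Suc i)) * g = f - swap_vars i f"
    using ddiff_exists[of i f] xv_diff_nonzero[of i "Suc i"]
    by (metis mult_left_cancel n_not_Suc_n)
  then show ?thesis unfolding ddiff_def by (rule theI')
qed

lemma ddiff_eqI:
  assumes "(xv i - xv (Suc i)) * g = f - swap_vars i f"
  shows "ddiff i f = g"
  using assms ddiff_eq[of i f] xv_diff_nonzero[of i "Suc i"]
  by (metis mult_left_cancel n_not_Suc_n)

lemma swap_vars_ddiff [simp]: "swap_vars i (ddiff i f) = ddiff i f"
proof -
  have "swap_vars i ((xv i - xv (Suc i)) * ddiff i f) = swap_vars i (f - swap_vars i f)"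
    by (simp add: ddiff_eq)
  then have "(xv (Suc i) - xv i) * swap_vars i (ddiff i f) = swap_vars i f - f"
    by (simp add: swap.map_simps)
  then have "(xv i - xv (Suc i)) * swap_vars i (ddiff i f) = f - swap_vars i f"
    by (simp add: algebra_simps)
  then show ?thesis by (metis ddiff_eqI)
qed

lemma pi_bar_conv_ddiff: "pi_bar i f = ddiff i ((1 - xv (Suc i)) * (xv i * f))"
  by (simp add: pi_bar_def ddiff_bar_def)

lemma pi_bar_eq:
  "(xv i - xv (Suc i)) * pi_bar i f =
    xv i * (1 - xv (Suc i)) * f - xv (Suc i) * (1 - xv i) * swap_vars i f"
  unfolding pi_bar_conv_ddiff ddiff_eq by (simp add: swap.map_simps algebra_simps)

text \<open>
  The algebraic rules for the operator follow from this characterization, which rests on cancelling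
  $x_i - x_{i+1}$.
\<close>

lemma pi_bar_eqI:
  assumes "(xv i - xv (Suc i)) * g =
    xv i * (1 - xv (Suc i)) * f - xv (Suc i) * (1 - xv i) * swap_vars i f"
  shows "pi_bar i f = g"
  using assms pi_bar_eq[of i f] xv_diff_nonzero[of i "Suc i"]
  by (metis mult_left_cancel n_not_Suc_n)

lemma swap_vars_pi_bar [simp]: "swap_vars i (pi_bar i f) = pi_bar i f"
  by (simp add: pi_bar_conv_ddiff)

lemma pi_bar_symmetric_mult:
  assumes "swap_vars i p = p"
  shows "pi_bar i (p * f) = p * pi_bar i f"
proof (rule pi_bar_eqI)
  have "(xv i - xv (Suc i)) * (p * pi_bar i f) = p * ((xv i - xv (Suc i)) * pi_bar i f)"
    by (simp add: algebra_simps)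
  also have "\<dots> = xv i * (1 - xv (Suc i)) * (p * f) - xv (Suc i) * (1 - xv i) * swap_vars i (p * f)"
    unfolding pi_bar_eq by (simp add: swap.map_simps assms algebra_simps)
  finally show "(xv i - xv (Suc i)) * (p * pi_bar i f) = \<dots>" .
qed

lemma pi_bar_one: "pi_bar i 1 = 1"
  by (rule pi_bar_eqI) (simp add: swap.map_simps algebra_simps)

lemma pi_bar_symmetric: "swap_vars i p = p \<Longrightarrow> pi_bar i p = p"
  using pi_bar_symmetric_mult[of i p 1] by (simp add: pi_bar_one)

lemma pi_bar_idem [simp]: "pi_bar i (pi_bar i f) = pi_bar i f"
  by (rule pi_bar_symmetric) simp

lemma pi_bar_add: "pi_bar i (f + g) = pi_bar i f + pi_bar i g"
  by (rule pi_bar_eqI, simp only: distrib_left pi_bar_eq) (simp add: swap.map_simps algebra_simps)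

lemma pi_bar_uminus: "pi_bar i (- f) = - pi_bar i f"
  using pi_bar_symmetric_mult[of i "-1" f] by (simp add: swap.map_simps)

lemma pi_bar_zero [simp]: "pi_bar i 0 = 0"
  using pi_bar_symmetric_mult[of i 0 0] by (simp add: swap.map_simps)

lemma swap_vars_commute:
  assumes "i \<noteq> j" "Suc i \<noteq> j" "Suc j \<noteq> i"
  shows "swap_vars i (swap_vars j f) = swap_vars j (swap_vars i f)"
proof (rule ring_map_unique[of "\<lambda>f. swap_vars i (swap_vars j f)" "\<lambda>f. swap_vars j (swap_vars i f)"])
  fix v
  show "swap_vars i (swap_vars j (pvar v)) = swap_vars j (swap_vars i (pvar v))"
    using assms by (cases v) (auto simp: transpose_def)
qed (rule ring_map_comp[OF swap.ring_map_axioms swap.ring_map_axioms])+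

lemma swap_vars_braid:
  "swap_vars i (swap_vars (Suc i) (swap_vars i f)) =
    swap_vars (Suc i) (swap_vars i (swap_vars (Suc i) f))"
proof (rule ring_map_unique[of "\<lambda>f. swap_vars i (swap_vars (Suc i) (swap_vars i f))"
      "\<lambda>f. swap_vars (Suc i) (swap_vars i (swap_vars (Suc i) f))"])
  fix v
  show "swap_vars i (swap_vars (Suc i) (swap_vars i (pvar v))) =
    swap_vars (Suc i) (swap_vars i (swap_vars (Suc i) (pvar v)))"
    by (cases v) (auto simp: transpose_def)
qed (rule ring_map_comp[OF ring_map_comp[OF swap.ring_map_axioms swap.ring_map_axioms]
      swap.ring_map_axioms])+

lemma swap_vars_pi_bar_commute:
  assumes "i \<noteq> j" "Suc i \<noteq> j" "Suc j \<noteq> i"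
  shows "swap_vars i (pi_bar j f) = pi_bar j (swap_vars i f)"
proof (rule pi_bar_eqI[symmetric])
  have fixed: "swap_vars i (xv j) = xv j" "swap_vars i (xv (Suc j)) = xv (Suc j)"
    using assms by (simp_all add: transpose_def)
  have "swap_vars i ((xv j - xv (Suc j)) * pi_bar j f) =
    swap_vars i (xv j * (1 - xv (Suc j)) * f - xv (Suc j) * (1 - xv j) * swap_vars j f)"
    by (simp only: pi_bar_eq)
  then show "(xv j - xv (Suc j)) * swap_vars i (pi_bar j f) =
    xv j * (1 - xv (Suc j)) * swap_vars i f - xv (Suc j) * (1 - xv j) * swap_vars j (swap_vars i f)"
    by (simp only: swap.map_simps fixed swap_vars_commute[OF assms])
qed

lemma pi_bar_diff: "pi_bar i (f - g) = pi_bar i f - pi_bar i g"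
  using pi_bar_add[of i f "- g"] by (simp add: pi_bar_uminus)

lemma pi_bar_commute:
  assumes "i \<noteq> j" "Suc i \<noteq> j" "Suc j \<noteq> i"
  shows "pi_bar i (pi_bar j f) = pi_bar j (pi_bar i f)"
proof (rule pi_bar_eqI)
  have sym: "swap_vars j (xv i * (1 - xv (Suc i))) = xv i * (1 - xv (Suc i))"
    "swap_vars j (xv (Suc i) * (1 - xv i)) = xv (Suc i) * (1 - xv i)"
    "swap_vars j (xv i - xv (Suc i)) = xv i - xv (Suc i)"
    using assms by (simp_all add: swap.map_simps transpose_def)
  have "(xv i - xv (Suc i)) * pi_bar j (pi_bar i f) = pi_bar j ((xv i - xv (Suc i)) * pi_bar i f)"
    by (simp only: pi_bar_symmetric_mult[OF sym(3)])
  also have "\<dots> = xv i * (1 - xv (Suc i)) * pi_bar j f -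
      xv (Suc i) * (1 - xv i) * swap_vars i (pi_bar j f)"
    by (simp only: pi_bar_eq pi_bar_diff pi_bar_symmetric_mult[OF sym(1)]
        pi_bar_symmetric_mult[OF sym(2)] swap_vars_pi_bar_commute[OF assms])
  finally show "(xv i - xv (Suc i)) * pi_bar j (pi_bar i f) = \<dots>" .
qed

text \<open>
  Three successive operators in the variables $x, y, z$ yield the alternating sum over all permutations
  of $x, y, z$ applied to $x^2 y (1 - y) (1 - z)^2 f$, divided by $(x - y)(x - z)(y - z)$. The letters
  in front of \<open>f\<close>, \<open>a\<close> and \<open>b\<close> record applied transpositions \<open>s\<close>, \<open>t\<close> (and \<open>w\<close> their longest product);
  the hypotheses are the defining equations of the operators together with the images of these
  equations under transpositions, so that the computation takes place in a bare integral domain.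
\<close>

lemma braid_numerator:
  fixes x y z f sf tf stf tsf wf a ta b sb c sta :: "'a::idom"
  assumes "x \<noteq> y"
    and a: "(x - y) * a = x * (1 - y) * f - y * (1 - x) * sf"
    and ta: "(x - z) * ta = x * (1 - z) * tf - z * (1 - x) * tsf"
    and b: "(y - z) * b = y * (1 - z) * a - z * (1 - y) * ta"
    and sta: "(y - z) * sta = y * (1 - z) * stf - z * (1 - y) * wf"
    and sb: "(x - z) * sb = x * (1 - z) * a - z * (1 - x) * sta"
    and c: "(x - y) * c = x * (1 - y) * b - y * (1 - x) * sb"
  shows "(x - y) * (x - z) * (y - z) * c =
      x^2 * y * (1 - y) * (1 - z)^2 * f - y^2 * x * (1 - x) * (1 - z)^2 * sf
      - x^2 * z * (1 - z) * (1 - y)^2 * tf + z^2 * x * (1 - x) * (1 - y)^2 * tsf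
      + y^2 * z * (1 - z) * (1 - x)^2 * stf - z^2 * y * (1 - y) * (1 - x)^2 * wf" (is "_ = ?R")
proof -
  have "(x - y) * (x - z) * ((y - z) * b) =
      (x - z) * y * (1 - z) * ((x - y) * a) - (x - y) * z * (1 - y) * ((x - z) * ta)"
    unfolding b by algebra
  also have "\<dots> = (x - z) * y * (1 - z) * (x * (1 - y) * f - y * (1 - x) * sf)
     - (x - y) * z * (1 - y) * (x * (1 - z) * tf - z * (1 - x) * tsf)"
    unfolding a ta ..
  finally have B: "(x - y) * (x - z) * ((y - z) * b) = \<dots>" .
  have "(x - y) * (y - z) * ((x - z) * sb) =
      (y - z) * x * (1 - z) * ((x - y) * a) - (x - y) * z * (1 - x) * ((y - z) * sta)"
    unfolding sb by algebra
  also have "\<dots> = (y - z) * x * (1 - z) * (x * (1 - y) * f - y * (1 - x) * sf)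
     - (x - y) * z * (1 - x) * (y * (1 - z) * stf - z * (1 - y) * wf)"
    unfolding a sta ..
  finally have SB: "(x - y) * (y - z) * ((x - z) * sb) = \<dots>" .
  have "(x - y) * ((x - y) * (x - z) * (y - z) * c) =
    (x - y) * (x - z) * (y - z) * ((x - y) * c)" by algebra
  also have "\<dots> = x * (1 - y) * ((x - y) * (x - z) * ((y - z) * b))
     - y * (1 - x) * ((x - y) * (y - z) * ((x - z) * sb))"
    unfolding c by algebra
  also have "\<dots> = (x - y) * ?R"
    unfolding B SB by algebra
  finally show ?thesis using \<open>x \<noteq> y\<close> by simp
qed

lemma pi_bar_braid:
  "pi_bar i (pi_bar (Suc i) (pi_bar i f)) = pi_bar (Suc i) (pi_bar i (pi_bar (Suc i) f))"
proof -
  let ?s = "swap_vars i" and ?t = "swap_vars (Suc i)"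
  let ?x = "xv i" and ?y = "xv (Suc i)" and ?z = "xv (Suc (Suc i))"
  let ?A = "pi_bar i" and ?B = "pi_bar (Suc i)"
  have vars: "?s ?x = ?y" "?s ?y = ?x" "?s ?z = ?z" "?t ?x = ?x" "?t ?y = ?z" "?t ?z = ?y"
    by (simp_all add: transpose_def)
  have ne: "?x \<noteq> ?y" "?y \<noteq> ?z" "?x \<noteq> ?z" by simp_all
  have A: "(?x - ?y) * ?A g = ?x * (1 - ?y) * g - ?y * (1 - ?x) * ?s g" for g
    by (rule pi_bar_eq)
  have B: "(?y - ?z) * ?B g = ?y * (1 - ?z) * g - ?z * (1 - ?y) * ?t g" for g
    by (rule pi_bar_eq)
  have tA: "(?x - ?z) * ?t (?A g) = ?x * (1 - ?z) * ?t g - ?z * (1 - ?x) * ?t (?s g)" for g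
    using arg_cong[OF A[of g], of ?t] by (simp only: swap.map_simps vars)
  have sB: "(?x - ?z) * ?s (?B g) = ?x * (1 - ?z) * ?s g - ?z * (1 - ?x) * ?s (?t g)" for g
    using arg_cong[OF B[of g], of ?s] by (simp only: swap.map_simps vars)
  have stA: "(?y - ?z) * ?s (?t (?A g)) = ?y * (1 - ?z) * ?s (?t g) - ?z * (1 - ?y) * ?s (?t (?s g))" for g
    using arg_cong[OF tA[of g], of ?s] by (simp only: swap.map_simps vars)
  have tsB: "(?x - ?y) * ?t (?s (?B g)) = ?x * (1 - ?y) * ?t (?s g) - ?y * (1 - ?x) * ?t (?s (?t g))" for g
    using arg_cong[OF sB[of g], of ?t] by (simp only: swap.map_simps vars)
  have "(?x - ?y) * (?x - ?z) * (?y - ?z) * ?A (?B (?A f)) =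
      ?x^2 * ?y * (1 - ?y) * (1 - ?z)^2 * f - ?y^2 * ?x * (1 - ?x) * (1 - ?z)^2 * ?s f
      - ?x^2 * ?z * (1 - ?z) * (1 - ?y)^2 * ?t f + ?z^2 * ?x * (1 - ?x) * (1 - ?y)^2 * ?t (?s f)
      + ?y^2 * ?z * (1 - ?z) * (1 - ?x)^2 * ?s (?t f)
      - ?z^2 * ?y * (1 - ?y) * (1 - ?x)^2 * ?s (?t (?s f))"
    using sB[of "?A f"]
    by (intro braid_numerator[where a = "?A f" and ta = "?t (?A f)" and b = "?B (?A f)" and
          sb = "?s (?B (?A f))" and sta = "?s (?t (?A f))"] ne A B tA stA) simp
  \<comment> \<open>The defining equation is invariant under the exchange of $x, y$ with $1 - y, 1 - x$. Hence the
     other side is the same computation with $1 - z, 1 - y, 1 - x$ in place of $x, y, z$, and the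
     numerator found there is the same alternating sum.\<close>
  moreover have "((1 - ?z) - (1 - ?y)) * ((1 - ?z) - (1 - ?x)) * ((1 - ?y) - (1 - ?x)) * ?B (?A (?B f)) =
      (1 - ?z)^2 * (1 - ?y) * (1 - (1 - ?y)) * (1 - (1 - ?x))^2 * f
      - (1 - ?y)^2 * (1 - ?z) * (1 - (1 - ?z)) * (1 - (1 - ?x))^2 * ?t f
      - (1 - ?z)^2 * (1 - ?x) * (1 - (1 - ?x)) * (1 - (1 - ?y))^2 * ?s f
      + (1 - ?x)^2 * (1 - ?z) * (1 - (1 - ?z)) * (1 - (1 - ?y))^2 * ?s (?t f)
      + (1 - ?y)^2 * (1 - ?x) * (1 - (1 - ?x)) * (1 - (1 - ?z))^2 * ?t (?s f)
      - (1 - ?x)^2 * (1 - ?y) * (1 - (1 - ?y)) * (1 - (1 - ?z))^2 * ?t (?s (?t f))"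
    using tA[of "?B f"]
    by (intro braid_numerator[where a = "?B f" and ta = "?s (?B f)" and b = "?A (?B f)" and
          sb = "?t (?A (?B f))" and sta = "?t (?s (?B f))"])
      (use A[of "?B f"] B[of f] B[of "?A (?B f)"] sB[of f] tsB[of f] ne in
        \<open>simp_all add: mult.commute mult.left_commute\<close>)
  ultimately have "(?x - ?y) * (?x - ?z) * (?y - ?z) * ?A (?B (?A f)) =
    (?x - ?y) * (?x - ?z) * (?y - ?z) * ?B (?A (?B f))"
    unfolding swap_vars_braid by (simp add: mult.commute mult.left_commute)
  then show ?thesis using ne by simp
qed

section \<open>Lascoux polynomials\<close>

abbreviation (input) swap_at :: "(nat \<Rightarrow> nat) \<Rightarrow> nat \<Rightarrow> nat \<Rightarrow> nat" where
  "swap_at \<alpha> i \<equiv> \<alpha> \<circ> transpose i (Suc i)"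

lemma composition_induct [case_names less]:
  assumes "\<And>\<alpha>. (\<And>i. ascent n \<alpha> i \<Longrightarrow> P (swap_at \<alpha> i)) \<Longrightarrow> P \<alpha>"
  shows "P \<alpha>"
  by (induction \<alpha> rule: measure_induct_rule[of "\<lambda>\<alpha>. \<Sum>a\<in>{1..n}. a * \<alpha> a"])
    (use assms weight_swap_less in blast)

text \<open>
  By the braid and commutation relations, the recursion may use any ascent instead of the first one.
  If the two ascents are adjacent, both reductions meet after three swaps; otherwise, after two.
\<close>

lemma lascoux_ascent:
  assumes "ascent n \<alpha> i"
  shows "lascoux n \<alpha> = pi_bar i (lascoux n (swap_at \<alpha> i))"
  using assms
proof (induction \<alpha> arbitrary: i rule: measure_induct_rule[of "\<lambda>\<alpha>. \<Sum>a\<in>{1..n}. a * \<alpha> a"])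
  case (less \<alpha>)
  define j where "j = (LEAST i. ascent n \<alpha> i)"
  have j: "ascent n \<alpha> j" "j \<le> i"
    unfolding j_def using less.prems by (auto intro: LeastI Least_le)
  have L: "lascoux n \<alpha> = pi_bar j (lascoux n (swap_at \<alpha> j))"
    using less.prems by (subst lascoux.simps) (auto simp: j_def Let_def)
  have IH: "lascoux n (swap_at \<alpha> l) = pi_bar k (lascoux n (swap_at (swap_at \<alpha> l) k))"
    if "ascent n \<alpha> l" "ascent n (swap_at \<alpha> l) k" for k l
    using less.IH weight_swap_less that by blast
  have IH2: "lascoux n (swap_at (swap_at \<alpha> l) l') =
      pi_bar k (lascoux n (swap_at (swap_at (swap_at \<alpha> l) l') k))"
    if "ascent n \<alpha> l" "ascent n (swap_at \<alpha> l) l'" "ascent n (swap_at (swap_at \<alpha> l) l') k" for k l l'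
    using less.IH[of "swap_at (swap_at \<alpha> l) l'"] weight_swap_less[OF that(1)]
      weight_swap_less[OF that(2)] that(3) by fastforce
  consider "i = j" | "i = Suc j" | "Suc j < i" using j(2) by linarith
  then show ?case
  proof cases
    case 1
    then show ?thesis using L by (simp only:)
  next
    case 2
    have asc: "ascent n (swap_at \<alpha> j) i" "ascent n (swap_at \<alpha> i) j"
        "ascent n (swap_at (swap_at \<alpha> j) i) j" "ascent n (swap_at (swap_at \<alpha> i) j) i"
      using less.prems j(1) 2 by (auto simp: ascent_def transpose_def)
    have eq: "swap_at (swap_at (swap_at \<alpha> j) i) j = swap_at (swap_at (swap_at \<alpha> i) j) i"
      using 2 by (auto simp: fun_eq_iff transpose_def)
    have "lascoux n \<alpha> = pi_bar j (pi_bar i (pi_bar j (lascoux n (swap_at (swap_at (swap_at \<alpha> j) i) j))))"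
      using L IH[OF j(1) asc(1)] IH2[OF j(1) asc(1,3)] by simp
    also have "\<dots> = pi_bar i (pi_bar j (pi_bar i (lascoux n (swap_at (swap_at (swap_at \<alpha> i) j) i))))"
      unfolding eq using pi_bar_braid 2 by simp
    also have "\<dots> = pi_bar i (lascoux n (swap_at \<alpha> i))"
      using IH[OF less.prems asc(2)] IH2[OF less.prems asc(2,4)] by simp
    finally show ?thesis .
  next
    case 3
    have asc: "ascent n (swap_at \<alpha> j) i" "ascent n (swap_at \<alpha> i) j"
      using less.prems j(1) 3 by (auto simp: ascent_def transpose_def)
    have eq: "swap_at (swap_at \<alpha> j) i = swap_at (swap_at \<alpha> i) j"
      using 3 by (auto simp: fun_eq_iff transpose_def)
    have "lascoux n \<alpha> = pi_bar j (pi_bar i (lascoux n (swap_at (swap_at \<alpha> j) i)))"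
      using L IH[OF j(1) asc(1)] by simp
    also have "\<dots> = pi_bar i (pi_bar j (lascoux n (swap_at (swap_at \<alpha> i) j)))"
      unfolding eq using pi_bar_commute[of j i] 3 by simp
    also have "\<dots> = pi_bar i (lascoux n (swap_at \<alpha> i))"
      using IH[OF less.prems asc(2)] by simp
    finally show ?thesis .
  qed
qed

definition x_monomial :: "nat \<Rightarrow> (nat \<Rightarrow> nat) \<Rightarrow> pol" where
  "x_monomial n \<alpha> = (\<Prod>a\<in>{1..n}. xv a ^ \<alpha> a)"

lemma lascoux_dominant: "\<nexists>i. ascent n \<alpha> i \<Longrightarrow> lascoux n \<alpha> = x_monomial n \<alpha>"
  by (subst lascoux.simps) (auto simp: x_monomial_def)

lemma swap_vars_prod_symmetric:
  assumes "\<And>a. a \<in> A \<Longrightarrow> transpose i (Suc i) a \<in> A"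
    and "\<And>a. a \<in> A \<Longrightarrow> swap_vars i (F a) = F (transpose i (Suc i) a)"
  shows "swap_vars i (\<Prod>a\<in>A. F a) = (\<Prod>a\<in>A. F a)"
proof -
  have "swap_vars i (\<Prod>a\<in>A. F a) = (\<Prod>a\<in>A. F (transpose i (Suc i) a))"
    using assms(2) by (simp add: swap.map_simps)
  also have "\<dots> = (\<Prod>a\<in>A. F a)"
    by (rule prod.reindex_bij_witness[of _ "transpose i (Suc i)" "transpose i (Suc i)"])
      (auto intro: assms(1))
  finally show ?thesis .
qed

lemma swap_vars_x_monomial:
  assumes "1 \<le> i" "i < n" "\<alpha> i = \<alpha> (Suc i)"
  shows "swap_vars i (x_monomial n \<alpha>) = x_monomial n \<alpha>"
  unfolding x_monomial_def using assms
  by (intro swap_vars_prod_symmetric) (auto simp: swap.map_simps transpose_def)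

text \<open>
  At an ascent this is idempotence. If $\alpha_i = \alpha_{i+1}$, then $\mathfrak L_\alpha$ is symmetric in
  $x_i, x_{i+1}$, which follows by induction: an ascent \<open>j\<close> adjacent to \<open>i\<close> gives
  $\mathfrak L_\alpha = \overline\pi_j \overline\pi_i \mathfrak L_\gamma$ with $\gamma_j = \gamma_{j+1}$, and
  the braid relation moves the equality from $\gamma$ to $\alpha$.
\<close>

lemma pi_bar_lascoux:
  assumes "1 \<le> i" "i < n" "\<alpha> i \<le> \<alpha> (Suc i)"
  shows "pi_bar i (lascoux n \<alpha>) = lascoux n \<alpha>"
  using assms
proof (induction \<alpha> arbitrary: i rule: measure_induct_rule[of "\<lambda>\<alpha>. \<Sum>a\<in>{1..n}. a * \<alpha> a"])
  case (less \<alpha>)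
  show ?case
  proof (cases "\<alpha> i < \<alpha> (Suc i)")
    case True
    then show ?thesis using less.prems lascoux_ascent[of n \<alpha> i] by (simp add: ascent_def)
  next
    case False
    then have eq: "\<alpha> i = \<alpha> (Suc i)" using less.prems by simp
    show ?thesis
    proof (cases "\<exists>j. ascent n \<alpha> j")
      case False
      then show ?thesis
        using swap_vars_x_monomial[of i n \<alpha>] eq less.prems
        by (intro pi_bar_symmetric) (simp add: lascoux_dominant)
    next
      case True
      then obtain j where j: "ascent n \<alpha> j" by blast
      then have L: "lascoux n \<alpha> = pi_bar j (lascoux n (swap_at \<alpha> j))" by (rule lascoux_ascent)
      have "i \<noteq> j" using j eq by (auto simp: ascent_def)
      show ?thesis
      proof (cases "j = Suc i \<or> i = Suc j")
        case True
        let ?\<gamma> = "swap_at (swap_at \<alpha> j) i"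
        have asc: "ascent n (swap_at \<alpha> j) i"
          using True j eq less.prems by (auto simp: ascent_def transpose_def)
        have "pi_bar j (lascoux n ?\<gamma>) = lascoux n ?\<gamma>"
          using weight_swap_less[OF j] weight_swap_less[OF asc] True j eq less.prems
          by (intro less.IH) (auto simp: ascent_def transpose_def)
        moreover have "lascoux n \<alpha> = pi_bar j (pi_bar i (lascoux n ?\<gamma>))"
          using L lascoux_ascent[OF asc] by simp
        ultimately show ?thesis
          using True pi_bar_braid[of i "lascoux n ?\<gamma>"] pi_bar_braid[of j "lascoux n ?\<gamma>"] by auto
      next
        case False
        have "pi_bar i (lascoux n (swap_at \<alpha> j)) = lascoux n (swap_at \<alpha> j)"
          using weight_swap_less[OF j] False \<open>i \<noteq> j\<close> eq less.prems
          by (intro less.IH) (auto simp: transpose_def)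
        then show ?thesis
          using L pi_bar_commute[of i j] False \<open>i \<noteq> j\<close> by simp
      qed
    qed
  qed
qed

lemma pi_bar_lascoux_cases:
  assumes "1 \<le> i" "i < n"
  shows "pi_bar i (lascoux n \<alpha>) = lascoux n \<alpha> \<or> pi_bar i (lascoux n \<alpha>) = lascoux n (swap_at \<alpha> i)"
proof (cases "\<alpha> i \<le> \<alpha> (Suc i)")
  case True
  then show ?thesis using pi_bar_lascoux assms by blast
next
  case False
  then have "ascent n (swap_at \<alpha> i) i" using assms by (simp add: ascent_def)
  then have "lascoux n (swap_at \<alpha> i) = pi_bar i (lascoux n (swap_at (swap_at \<alpha> i) i))"
    by (rule lascoux_ascent)
  then show ?thesis by (simp add: comp_assoc)
qed

section \<open>Graded nonnegative combinations\<close>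

text \<open>
  The sign $(-1)^{|\alpha|}$ is independent of the lowest degree of the polynomial, which makes this
  notion additive. The global sign is restored once the lowest degree is known.
\<close>

inductive graded_cone :: "nat \<Rightarrow> (nat \<Rightarrow> nat) set \<Rightarrow> pol \<Rightarrow> bool" for n S where
  zero: "graded_cone n S 0"
| step: "graded_cone n S p \<Longrightarrow> \<alpha> \<in> S \<Longrightarrow>
    graded_cone n S (p + (-1) ^ size_comp n \<alpha> * lascoux n \<alpha>)"

lemma graded_cone_generator:
  "\<alpha> \<in> S \<Longrightarrow> graded_cone n S ((-1) ^ size_comp n \<alpha> * lascoux n \<alpha>)"
  using graded_cone.step[OF graded_cone.zero] by simp

lemma graded_cone_add:
  assumes "graded_cone n S p" "graded_cone n S q"
  shows "graded_cone n S (p + q)"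
  using assms(2,1)
  by induction (auto simp: add.assoc[symmetric] intro: graded_cone.step)

lemma graded_cone_mono:
  assumes "graded_cone n S p" "S \<subseteq> T"
  shows "graded_cone n T p"
  using assms by induction (auto intro: graded_cone.intros)

lemma graded_cone_map:
  assumes "graded_cone n S p"
    and "\<And>\<alpha>. \<alpha> \<in> S \<Longrightarrow> graded_cone n T (F ((-1) ^ size_comp n \<alpha> * lascoux n \<alpha>))"
    and "F 0 = 0" "\<And>p q. F (p + q) = F p + F q"
  shows "graded_cone n T (F p)"
  using assms(1) by induction (auto simp: assms(3,4) intro: graded_cone.zero graded_cone_add assms(2))

lemma size_comp_swap:
  assumes "1 \<le> i" "i < n"
  shows "size_comp n (swap_at \<alpha> i) = size_comp n \<alpha>"
  unfolding size_comp_def using assms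
  by (intro sum.reindex_bij_witness[of _ "transpose i (Suc i)" "transpose i (Suc i)"])
    (auto simp: transpose_def)

lemma swap_vars_sign [simp]: "swap_vars i ((-1) ^ k) = (-1) ^ k"
  by (simp add: swap.map_simps)

lemma graded_cone_pi_bar:
  assumes "graded_cone n S p" "1 \<le> i" "i < n" "\<And>\<alpha>. \<alpha> \<in> S \<Longrightarrow> swap_at \<alpha> i \<in> S"
  shows "graded_cone n S (pi_bar i p)"
proof (rule graded_cone_map[OF assms(1)])
  fix \<alpha> assume \<alpha>: "\<alpha> \<in> S"
  have "pi_bar i ((-1) ^ size_comp n \<alpha> * lascoux n \<alpha>) = (-1) ^ size_comp n \<alpha> * pi_bar i (lascoux n \<alpha>)"
    by (rule pi_bar_symmetric_mult) simp
  then show "graded_cone n S (pi_bar i ((-1) ^ size_comp n \<alpha> * lascoux n \<alpha>))"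
    using pi_bar_lascoux_cases[OF assms(2,3), of \<alpha>] graded_cone_generator[OF \<alpha>]
      graded_cone_generator[OF assms(4)[OF \<alpha>]] size_comp_swap[OF assms(2,3), of \<alpha>]
    by metis
qed (simp_all add: pi_bar_add)

abbreviation dominant :: "nat \<Rightarrow> (nat \<Rightarrow> nat) \<Rightarrow> bool" where
  "dominant n \<alpha> \<equiv> \<nexists>i. ascent n \<alpha> i"

lemma dominantD:
  assumes "dominant n \<alpha>" "1 \<le> a" "a \<le> b" "b \<le> n"
  shows "\<alpha> b \<le> \<alpha> a"
  using assms(3,4)
proof (induction b rule: dec_induct)
  case (step c)
  then have "1 \<le> c" "c < n" using assms by auto
  then have "\<alpha> (Suc c) \<le> \<alpha> c" using assms(1) by (meson ascent_def not_less)
  then show ?case using step by simp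
qed simp

lemma compositions_swap:
  assumes "\<alpha> \<in> compositions n" "1 \<le> i" "i < n"
  shows "swap_at \<alpha> i \<in> compositions n"
  using assms by (auto simp: compositions_def PiE_def extensional_def transpose_def)

definition one_minus_tail :: "nat \<Rightarrow> nat \<Rightarrow> pol" where
  "one_minus_tail n k = (\<Prod>a\<in>{k<..n}. 1 - xv a)"

lemma swap_vars_one_minus_tail:
  assumes "i < n" "i \<noteq> k"
  shows "swap_vars i (one_minus_tail n k) = one_minus_tail n k"
  unfolding one_minus_tail_def using assms
  by (intro swap_vars_prod_symmetric) (auto simp: swap.map_simps transpose_def)

lemma pi_bar_one_minus: "pi_bar i (1 - xv i) = (1 - xv i) * (1 - xv (Suc i))"
  by (rule pi_bar_eqI) (simp add: swap.map_simps algebra_simps)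

lemma greaterThanAtMost_Suc: "k \<le> j \<Longrightarrow> {k<..Suc j} = insert (Suc j) {k<..j}"
  by auto

lemma x_monomial_increment:
  assumes "a \<in> {1..n}"
  shows "x_monomial n (\<alpha>(a := Suc (\<alpha> a))) = xv a * x_monomial n \<alpha>"
proof -
  have "x_monomial n \<beta> = xv a ^ \<beta> a * (\<Prod>b\<in>{1..n}-{a}. xv b ^ \<beta> b)" for \<beta>
    unfolding x_monomial_def using assms by (simp add: prod.remove)
  moreover have "(\<Prod>b\<in>{1..n}-{a}. xv b ^ (\<alpha>(a := Suc (\<alpha> a))) b) = (\<Prod>b\<in>{1..n}-{a}. xv b ^ \<alpha> b)"
    by (intro prod.cong) auto
  ultimately show ?thesis by simp
qed

lemma size_comp_increment:
  assumes "a \<in> {1..n}"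
  shows "size_comp n (\<alpha>(a := Suc (\<alpha> a))) = Suc (size_comp n \<alpha>)"
proof -
  have "size_comp n \<beta> = \<beta> a + (\<Sum>b\<in>{1..n}-{a}. \<beta> b)" for \<beta>
    unfolding size_comp_def using assms by (simp add: sum.remove)
  moreover have "(\<Sum>b\<in>{1..n}-{a}. (\<alpha>(a := Suc (\<alpha> a))) b) = (\<Sum>b\<in>{1..n}-{a}. \<alpha> b)"
    by (intro sum.cong) auto
  ultimately show ?thesis by simp
qed

text \<open>
  The identity behind this is $\overline\pi_j(1 - x_j) = (1 - x_j)(1 - x_{j+1})$.
\<close>

lemma pi_bar_extends_one_minus_block:
  assumes "k < j" and sym: "swap_vars j g = g"
  shows "pi_bar j (g * (\<Prod>a\<in>{k<..j}. 1 - xv a)) = g * (\<Prod>a\<in>{k<..Suc j}. 1 - xv a)"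
proof -
  obtain i where i: "j = Suc i" "k \<le> i" using \<open>k < j\<close> by (cases j) auto
  let ?h = "g * (\<Prod>a\<in>{k<..i}. 1 - xv a)"
  have "swap_vars j (\<Prod>a\<in>{k<..i}. 1 - xv a) = (\<Prod>a\<in>{k<..i}. 1 - xv a)"
    using i by (simp add: swap.map_simps)
  then have "swap_vars j ?h = ?h" by (simp add: swap.map_mult sym)
  then have "pi_bar j (?h * (1 - xv j)) = ?h * ((1 - xv j) * (1 - xv (Suc j)))"
    by (simp only: pi_bar_symmetric_mult pi_bar_one_minus)
  then show ?thesis using i by (simp add: greaterThanAtMost_Suc mult.commute mult.left_commute)
qed

text \<open>
  The entries of $\kappa$ after position \<open>k\<close> fall into blocks of equal entries. For the first block
  $k + 1, \ldots, e$, the factor $1 - x_{k+1}$ splits $x^\kappa (1 - x_{k+1}) \prod_{a>e} (1 - x_a)$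
  into two terms of the same kind, with exponent $\kappa$ and with its entry $k + 1$ raised by one;
  both exponents are weakly decreasing, and as the size grows by one, the sign fits. The operators
  $\overline\pi_{k+1}, \ldots, \overline\pi_{e-1}$ then supply the remaining factors of the block,
  since everything else is symmetric in the block. The condition at \<open>k\<close> says that a block ends
  there, so that raising the entry $k + 1$ keeps the exponent weakly decreasing.
\<close>

lemma graded_cone_monomial_times_tail:
  assumes "\<kappa> \<in> compositions n" "dominant n \<kappa>" "k \<le> n"
    and "k = 0 \<or> k = n \<or> \<kappa> (Suc k) < \<kappa> k"
    and "\<And>a. a \<in> {1..n} \<Longrightarrow> \<kappa> a \<le> c" "\<And>a. a \<in> {k<..n} \<Longrightarrow> \<kappa> a < c"
  shows "graded_cone n {\<alpha> \<in> compositions n. (\<forall>a\<in>{1..k}. \<alpha> a = \<kappa> a) \<and> (\<forall>a\<in>{1..n}. \<alpha> a \<le> c)}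
    ((-1) ^ size_comp n \<kappa> * x_monomial n \<kappa> * one_minus_tail n k)"
  using assms
proof (induction "n - k" arbitrary: k \<kappa> rule: less_induct)
  case less
  let ?S = "\<lambda>k \<kappa>. {\<alpha> \<in> compositions n. (\<forall>a\<in>{1..k}. \<alpha> a = \<kappa> a) \<and> (\<forall>a\<in>{1..n}. \<alpha> a \<le> c)}"
  show ?case
  proof (cases "k = n")
    case True
    have "graded_cone n (?S k \<kappa>) ((-1) ^ size_comp n \<kappa> * lascoux n \<kappa>)"
      using less.prems by (intro graded_cone_generator) auto
    then show ?thesis using True less.prems(2) by (simp add: one_minus_tail_def lascoux_dominant)
  next
    case False
    then have kn: "Suc k \<le> n" using less.prems by simp
    define e where "e = Max {a \<in> {1..n}. \<kappa> a = \<kappa> (Suc k)}"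
    have "e \<in> {a \<in> {1..n}. \<kappa> a = \<kappa> (Suc k)}"
      unfolding e_def using kn by (intro Max_in) auto
    then have e: "e \<le> n" "\<kappa> e = \<kappa> (Suc k)" by auto
    have ge: "a \<le> e" if "a \<in> {1..n}" "\<kappa> a = \<kappa> (Suc k)" for a
      unfolding e_def using that by (intro Max_ge) auto
    have ke: "k < e" using ge[of "Suc k"] kn by simp
    have block: "\<kappa> a = \<kappa> (Suc k)" if "k < a" "a \<le> e" for a
      using dominantD[OF less.prems(2), of a e] dominantD[OF less.prems(2), of "Suc k" a] that e by simp
    have below: "\<kappa> (Suc e) < \<kappa> e" if "e \<noteq> n"
    proof -
      have "\<kappa> (Suc e) \<noteq> \<kappa> (Suc k)" using ge[of "Suc e"] that e by auto
      moreover have "\<kappa> (Suc e) \<le> \<kappa> e" using dominantD[OF less.prems(2), of e "Suc e"] that e ke by simp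
      ultimately show ?thesis using e by simp
    qed
    define \<mu> where "\<mu> = \<kappa>(Suc k := Suc (\<kappa> (Suc k)))"
    have \<mu>_dominant: "dominant n \<mu>"
      using less.prems(2,4) False by (auto simp: \<mu>_def ascent_def split: if_splits)
    have "graded_cone n (?S e \<kappa>) ((-1) ^ size_comp n \<kappa> * x_monomial n \<kappa> * one_minus_tail n e)"
      using less.prems ke e below kn by (intro less.hyps) auto
    moreover have "graded_cone n (?S e \<mu>) ((-1) ^ size_comp n \<mu> * x_monomial n \<mu> * one_minus_tail n e)"
    proof (rule less.hyps)
      show "\<mu> \<in> compositions n"
        using less.prems(1) kn by (auto simp: \<mu>_def compositions_def PiE_def extensional_def)
      show "e = 0 \<or> e = n \<or> \<mu> (Suc e) < \<mu> e"
        using below ke by (cases "e = n") (auto simp: \<mu>_def less_SucI)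
      show "\<mu> a \<le> c" if "a \<in> {1..n}" for a
        using less.prems(5)[OF that] less.prems(6)[of "Suc k"] kn by (simp add: \<mu>_def)
      show "\<mu> a < c" if "a \<in> {e<..n}" for a
        using less.prems(6)[of a] that ke by (simp add: \<mu>_def)
    qed (use ke e kn \<mu>_dominant in auto)
    moreover have "?S e \<kappa> \<subseteq> ?S k \<kappa>" "?S e \<mu> \<subseteq> ?S k \<kappa>"
      using ke by (auto simp: \<mu>_def)
    ultimately have start: "graded_cone n (?S k \<kappa>)
        ((-1) ^ size_comp n \<kappa> * x_monomial n \<kappa> * one_minus_tail n e +
         (-1) ^ size_comp n \<mu> * x_monomial n \<mu> * one_minus_tail n e)"
      by (blast intro: graded_cone_add graded_cone_mono)
    \<comment> \<open>Grow the block product one factor at a time, from $1 - x_{k+1}$ to the whole block.\<close>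
    let ?g = "(-1) ^ size_comp n \<kappa> * x_monomial n \<kappa> * one_minus_tail n e"
    have "graded_cone n (?S k \<kappa>) (?g * (\<Prod>a\<in>{k<..j}. 1 - xv a))" if "Suc k \<le> j" "j \<le> e" for j
      using that
    proof (induction j rule: dec_induct)
      case base
      have "{k<..Suc k} = {Suc k}" by auto
      then show ?case
        using start kn by (simp add: \<mu>_def x_monomial_increment size_comp_increment algebra_simps)
    next
      case (step j)
      have "\<kappa> j = \<kappa> (Suc j)" using block[of j] block[of "Suc j"] step by simp
      then have "swap_vars j ?g = ?g"
        using step e by (simp add: swap.map_mult swap_vars_x_monomial swap_vars_one_minus_tail)
      then have "?g * (\<Prod>a\<in>{k<..Suc j}. 1 - xv a) = pi_bar j (?g * (\<Prod>a\<in>{k<..j}. 1 - xv a))"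
        using step by (intro pi_bar_extends_one_minus_block[symmetric]) auto
      moreover have "graded_cone n (?S k \<kappa>) (pi_bar j (?g * (\<Prod>a\<in>{k<..j}. 1 - xv a)))"
      proof (rule graded_cone_pi_bar)
        show "graded_cone n (?S k \<kappa>) (?g * (\<Prod>a\<in>{k<..j}. 1 - xv a))" using step by simp
        show "swap_at \<alpha> j \<in> ?S k \<kappa>" if "\<alpha> \<in> ?S k \<kappa>" for \<alpha>
          using that step e compositions_swap[of \<alpha> n j] by (auto simp: transpose_def)
      qed (use step e in auto)
      ultimately show ?case by simp
    qed
    from this[of e] have "graded_cone n (?S k \<kappa>) (?g * (\<Prod>a\<in>{k<..e}. 1 - xv a))"
      using ke by simp
    moreover have "one_minus_tail n k = one_minus_tail n e * (\<Prod>a\<in>{k<..e}. 1 - xv a)"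
    proof -
      have "{k<..n} = {e<..n} \<union> {k<..e}" "{e<..n} \<inter> {k<..e} = {}" using ke e by auto
      then show ?thesis unfolding one_minus_tail_def by (simp add: prod.union_disjoint)
    qed
    ultimately show ?thesis by (simp add: mult.assoc)
  qed
qed

section \<open>Seeds and their orbits\<close>

text \<open>
  The factor $P_k$ that a column $[n-k]$ contributes after the specialization.
\<close>

definition column_factor :: "nat \<Rightarrow> nat \<Rightarrow> pol" where
  "column_factor n k = (\<Prod>a\<in>{1..k}. xv a) * one_minus_tail n k"

lemma swap_vars_column_factor:
  assumes "1 \<le> i" "i < n" "i \<noteq> k"
  shows "swap_vars i (column_factor n k) = column_factor n k"
proof -
  have "swap_vars i (\<Prod>a\<in>{1..k}. xv a) = (\<Prod>a\<in>{1..k}. xv a)"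
    using assms by (intro swap_vars_prod_symmetric) (auto simp: transpose_def)
  then show ?thesis
    using assms by (simp add: column_factor_def swap.map_mult swap_vars_one_minus_tail)
qed

definition add_prefix :: "nat \<Rightarrow> (nat \<Rightarrow> nat) \<Rightarrow> nat \<Rightarrow> nat" where
  "add_prefix k \<alpha> a = (if a \<in> {1..k} then Suc (\<alpha> a) else \<alpha> a)"

lemma compositions_add_prefix:
  "\<alpha> \<in> compositions n \<Longrightarrow> k \<le> n \<Longrightarrow> add_prefix k \<alpha> \<in> compositions n"
  by (auto simp: add_prefix_def compositions_def PiE_def extensional_def)

lemma dominant_add_prefix:
  assumes "dominant n \<alpha>"
  shows "dominant n (add_prefix k \<alpha>)"
proof
  assume "\<exists>i. ascent n (add_prefix k \<alpha>) i"
  then obtain i where i: "1 \<le> i" "i < n" "add_prefix k \<alpha> i < add_prefix k \<alpha> (Suc i)"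
    by (auto simp: ascent_def)
  then have "\<alpha> (Suc i) \<le> \<alpha> i" using assms by (auto simp: ascent_def not_less)
  then show False using i by (auto simp: add_prefix_def split: if_splits)
qed

lemma size_comp_add_prefix:
  assumes "k \<le> n"
  shows "size_comp n (add_prefix k \<alpha>) = size_comp n \<alpha> + k"
proof -
  have "size_comp n (add_prefix k \<alpha>) = (\<Sum>a\<in>{1..n}. \<alpha> a + (if a \<in> {1..k} then 1 else 0))"
    unfolding size_comp_def add_prefix_def by (intro sum.cong) auto
  also have "\<dots> = size_comp n \<alpha> + (\<Sum>a\<in>{1..n}. if a \<in> {1..k} then 1 else 0)"
    by (simp add: sum.distrib size_comp_def)
  also have "(\<Sum>a\<in>{1..n}. if a \<in> {1..k} then 1 else 0) = (\<Sum>a\<in>{1..k}. 1 :: nat)"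
    using assms by (intro sum.mono_neutral_cong_right) auto
  finally show ?thesis by simp
qed

lemma x_monomial_add_prefix:
  assumes "k \<le> n"
  shows "x_monomial n (add_prefix k \<alpha>) = (\<Prod>a\<in>{1..k}. xv a) * x_monomial n \<alpha>"
proof -
  have "x_monomial n (add_prefix k \<alpha>) =
      (\<Prod>a\<in>{1..n}. (if a \<in> {1..k} then xv a else 1) * xv a ^ \<alpha> a)"
    unfolding x_monomial_def add_prefix_def by (intro prod.cong) auto
  also have "\<dots> = (\<Prod>a\<in>{1..n}. if a \<in> {1..k} then xv a else 1) * x_monomial n \<alpha>"
    by (simp add: prod.distrib x_monomial_def)
  also have "(\<Prod>a\<in>{1..n}. if a \<in> {1..k} then xv a else 1) = (\<Prod>a\<in>{1..k}. xv a)"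
    using assms by (intro prod.mono_neutral_cong_right) auto
  finally show ?thesis .
qed

text \<open>
  The compositions inside an $n \times c$ box whose first \<open>k\<close> entries fill it. Their ascents lie to the
  right of \<open>k\<close>, so the corresponding operators commute with $P_k$.
\<close>

definition box_compositions :: "nat \<Rightarrow> nat \<Rightarrow> nat \<Rightarrow> (nat \<Rightarrow> nat) set" where
  "box_compositions n k c =
    {\<alpha> \<in> compositions n. (\<forall>a\<in>{1..k}. \<alpha> a = c) \<and> (\<forall>a\<in>{1..n}. \<alpha> a \<le> c)}"

lemma box_compositions_swap:
  assumes "\<alpha> \<in> box_compositions n k c" "1 \<le> i" "i < n" "k < i"
  shows "swap_at \<alpha> i \<in> box_compositions n k c"
  using assms compositions_swap[of \<alpha> n i] by (auto simp: box_compositions_def transpose_def)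

text \<open>
  Since $P_k$ is symmetric in $x_i, x_{i+1}$ for all ascents \<open>i\<close> of \<open>\<alpha>\<close>, the operators that build
  $\mathfrak L_\alpha$ commute with multiplication by $P_k$. This reduces the claim to a weakly
  decreasing \<open>\<alpha>\<close>. There $P_k x^\alpha$ is the tail times a monomial in which the first \<open>k\<close>
  exponents have been raised by one, so that a block of equal exponents ends at \<open>k\<close>.
\<close>

lemma graded_cone_column_factor_lascoux:
  assumes "\<alpha> \<in> box_compositions n k c" "k \<le> n"
  shows "graded_cone n (box_compositions n k (Suc c))
    ((-1) ^ (size_comp n \<alpha> + k) * column_factor n k * lascoux n \<alpha>)"
  using assms(1)
proof (induction \<alpha> rule: composition_induct[of n])
  case (less \<alpha>)
  let ?T = "box_compositions n k (Suc c)"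
  show ?case
  proof (cases "\<exists>i. ascent n \<alpha> i")
    case True
    then obtain i where i: "ascent n \<alpha> i" by blast
    then have "\<alpha> i < \<alpha> (Suc i)" "\<alpha> (Suc i) \<le> c" and range: "1 \<le> i" "i < n"
      using less.prems by (auto simp: ascent_def box_compositions_def)
    have "\<alpha> i = c" if "i \<le> k" using that range(1) less.prems by (simp add: box_compositions_def)
    then have ki: "k < i" using \<open>\<alpha> i < \<alpha> (Suc i)\<close> \<open>\<alpha> (Suc i) \<le> c\<close> by linarith
    let ?g = "(-1) ^ (size_comp n \<alpha> + k) * column_factor n k"
    have "graded_cone n ?T (?g * lascoux n (swap_at \<alpha> i))"
      using less.IH[OF i box_compositions_swap[OF less.prems range ki]] size_comp_swap[OF range, of \<alpha>]
      by (simp add: comp_def)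
    then have "graded_cone n ?T (pi_bar i (?g * lascoux n (swap_at \<alpha> i)))"
      using range ki by (intro graded_cone_pi_bar) (auto intro: box_compositions_swap)
    moreover have "swap_vars i ?g = ?g"
      using range ki swap_vars_column_factor[of i n k] by (simp add: swap.map_mult)
    ultimately show ?thesis by (simp only: pi_bar_symmetric_mult lascoux_ascent[OF i])
  next
    case False
    let ?\<mu> = "add_prefix k \<alpha>"
    have "graded_cone n {\<beta> \<in> compositions n. (\<forall>a\<in>{1..k}. \<beta> a = ?\<mu> a) \<and> (\<forall>a\<in>{1..n}. \<beta> a \<le> Suc c)}
      ((-1) ^ size_comp n ?\<mu> * x_monomial n ?\<mu> * one_minus_tail n k)"
    proof (rule graded_cone_monomial_times_tail)
      show "?\<mu> \<in> compositions n"
        using less.prems assms(2) by (intro compositions_add_prefix) (auto simp: box_compositions_def)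
      show "dominant n ?\<mu>" using False by (rule dominant_add_prefix)
      show "k = 0 \<or> k = n \<or> ?\<mu> (Suc k) < ?\<mu> k"
        using less.prems assms(2)
        by (cases "k < n") (auto simp: box_compositions_def add_prefix_def less_Suc_eq_le)
      show "?\<mu> a \<le> Suc c" if "a \<in> {1..n}" for a
        using less.prems that by (auto simp: box_compositions_def add_prefix_def le_SucI)
      show "?\<mu> a < Suc c" if "a \<in> {k<..n}" for a
        using less.prems that by (auto simp: box_compositions_def add_prefix_def less_Suc_eq_le)
    qed (use assms in auto)
    moreover have "{\<beta> \<in> compositions n. (\<forall>a\<in>{1..k}. \<beta> a = ?\<mu> a) \<and> (\<forall>a\<in>{1..n}. \<beta> a \<le> Suc c)} = ?T"
      using less.prems by (auto simp: box_compositions_def add_prefix_def)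
    ultimately show ?thesis
      using False assms(2)
      by (simp add: lascoux_dominant size_comp_add_prefix x_monomial_add_prefix column_factor_def ac_simps)
  qed
qed

lemma graded_cone_column_factor:
  assumes "graded_cone n (box_compositions n k c) p" "k \<le> n"
  shows "graded_cone n (box_compositions n k (Suc c)) ((-1) ^ k * column_factor n k * p)"
proof (rule graded_cone_map[OF assms(1)])
  fix \<alpha> assume "\<alpha> \<in> box_compositions n k c"
  from graded_cone_column_factor_lascoux[OF this assms(2)]
  show "graded_cone n (box_compositions n k (Suc c))
    ((-1) ^ k * column_factor n k * ((-1) ^ size_comp n \<alpha> * lascoux n \<alpha>))"
    by (simp add: power_add mult.assoc mult.left_commute)
qed (simp_all add: distrib_left)

definition seed :: "nat \<Rightarrow> nat \<Rightarrow> (nat \<Rightarrow> nat) \<Rightarrow> pol" where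
  "seed n m \<nu> = (\<Prod>a\<in>{1..n}. xv a ^ \<nu> a * (1 - xv a) ^ (m - \<nu> a))"

lemma seed_add_prefix:
  assumes "k \<le> n" "\<And>a. a \<in> {1..n} \<Longrightarrow> \<nu> a \<le> m"
  shows "seed n (Suc m) (add_prefix k \<nu>) = column_factor n k * seed n m \<nu>"
proof -
  have "seed n (Suc m) (add_prefix k \<nu>) =
      (\<Prod>a\<in>{1..n}. (if a \<in> {1..k} then xv a else 1 - xv a) * (xv a ^ \<nu> a * (1 - xv a) ^ (m - \<nu> a)))"
    unfolding seed_def add_prefix_def
    by (intro prod.cong) (use assms(2) in \<open>auto simp: Suc_diff_le\<close>)
  also have "\<dots> = (\<Prod>a\<in>{1..n}. if a \<in> {1..k} then xv a else 1 - xv a) * seed n m \<nu>"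
    by (simp add: prod.distrib seed_def)
  also have "(\<Prod>a\<in>{1..n}. if a \<in> {1..k} then xv a else 1 - xv a) = column_factor n k"
  proof -
    have split: "{1..n} = {1..k} \<union> {k<..n}" "{1..k} \<inter> {k<..n} = {}" using assms(1) by auto
    show ?thesis
      unfolding column_factor_def one_minus_tail_def split(1)
      by (subst prod.union_disjoint) (auto intro!: arg_cong2[where f = "(*)"] prod.cong)
  qed
  finally show ?thesis .
qed

text \<open>
  A seed is built up by factors $P_k$ in the order of decreasing \<open>k\<close>: the last factor has
  $k = \#\{a : \nu_a = m\}$, and before it, the first \<open>k\<close> exponents are all $m - 1$. In this
  order the box condition of \<open>graded_cone_column_factor\<close> is available at each step.
\<close>

lemma graded_cone_seed:
  assumes "\<nu> \<in> compositions n" "dominant n \<nu>" "\<And>a. a \<in> {1..n} \<Longrightarrow> \<nu> a \<le> m"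
    and "k \<le> n" "\<And>a. a \<in> {1..k} \<Longrightarrow> \<nu> a = m"
  shows "graded_cone n (box_compositions n k m) ((-1) ^ size_comp n \<nu> * seed n m \<nu>)"
  using assms
proof (induction m arbitrary: \<nu> k)
  case 0
  then have "graded_cone n (box_compositions n k 0) ((-1) ^ size_comp n \<nu> * lascoux n \<nu>)"
    by (intro graded_cone_generator) (auto simp: box_compositions_def)
  moreover have "lascoux n \<nu> = seed n 0 \<nu>"
    using 0 by (simp add: lascoux_dominant x_monomial_def seed_def)
  ultimately show ?case by simp
next
  case (Suc m)
  define l where "l = card {a \<in> {1..n}. \<nu> a = Suc m}"
  have initial: "{a \<in> {1..n}. \<nu> a = Suc m} = {1..l}"
  proof -
    let ?A = "{a \<in> {1..n}. \<nu> a = Suc m}"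
    have down: "b \<in> ?A" if "a \<in> ?A" "1 \<le> b" "b \<le> a" for a b
      using dominantD[OF Suc.prems(2), of b a] Suc.prems(3)[of b] that by auto
    show ?thesis
    proof (cases "?A = {}")
      case False
      define M where "M = Max ?A"
      have M: "M \<in> ?A" unfolding M_def using False by (intro Max_in) auto
      have le: "b \<le> M" if "b \<in> ?A" for b unfolding M_def using that by (intro Max_ge) auto
      have "b \<in> ?A \<longleftrightarrow> b \<in> {1..M}" for b
        using down[OF M, of b] le[of b] by fastforce
      then have "?A = {1..M}" by blast
      then show ?thesis unfolding l_def by (metis card_atLeastAtMost diff_Suc_1)
    qed (simp add: l_def)
  qed
  then have top: "a \<in> {1..n} \<and> \<nu> a = Suc m \<longleftrightarrow> a \<in> {1..l}" for a by blast
  have ln: "l \<le> n" using top[of l] by (cases "l = 0") auto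
  have kl: "k \<le> l" using top[of k] Suc.prems(4) Suc.prems(5)[of k] by (cases "k = 0") auto
  define \<mu> where "\<mu> = (\<lambda>a. if a \<in> {1..l} then \<nu> a - 1 else \<nu> a)"
  have \<mu>: "\<mu> \<in> compositions n" "dominant n \<mu>" "\<And>a. a \<in> {1..n} \<Longrightarrow> \<mu> a \<le> m"
      "\<And>a. a \<in> {1..l} \<Longrightarrow> \<mu> a = m"
  proof -
    show "\<mu> \<in> compositions n"
      using Suc.prems(1) ln by (auto simp: \<mu>_def compositions_def PiE_def extensional_def)
    show le: "\<mu> a \<le> m" if "a \<in> {1..n}" for a
      using top[of a] Suc.prems(3)[OF that] that by (auto simp: \<mu>_def)
    show eq: "\<mu> a = m" if "a \<in> {1..l}" for a
      using top[of a] that by (simp add: \<mu>_def)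
    show "dominant n \<mu>"
    proof
      assume "\<exists>i. ascent n \<mu> i"
      then obtain i where i: "1 \<le> i" "i < n" "\<mu> i < \<mu> (Suc i)" by (auto simp: ascent_def)
      then have "i \<notin> {1..l}" using eq[of i] le[of "Suc i"] by auto
      then have "\<nu> i < \<nu> (Suc i)" using i by (auto simp: \<mu>_def)
      then show False using Suc.prems(2) i by (auto simp: ascent_def)
    qed
  qed
  have \<nu>: "\<nu> = add_prefix l \<mu>"
  proof
    show "\<nu> a = add_prefix l \<mu> a" for a
      using top[of a] by (auto simp: \<mu>_def add_prefix_def)
  qed
  have factor: "seed n (Suc m) \<nu> = column_factor n l * seed n m \<mu>"
    unfolding \<nu> by (rule seed_add_prefix[OF ln \<mu>(3)])
  have sizes: "size_comp n \<nu> = size_comp n \<mu> + l"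
    unfolding \<nu> by (rule size_comp_add_prefix[OF ln])
  have "graded_cone n (box_compositions n l (Suc m))
      ((-1) ^ l * column_factor n l * ((-1) ^ size_comp n \<mu> * seed n m \<mu>))"
    by (intro graded_cone_column_factor Suc.IH \<mu> ln)
  also have "(-1) ^ l * column_factor n l * ((-1) ^ size_comp n \<mu> * seed n m \<mu>) =
      (-1) ^ size_comp n \<nu> * seed n (Suc m) \<nu>"
    by (simp add: sizes factor power_add ac_simps)
  finally show ?case
    by (rule graded_cone_mono) (use kl in \<open>auto simp: box_compositions_def\<close>)
qed

text \<open>
  The polynomials obtained from a seed by sorting \<open>\<gamma>\<close> into a weakly decreasing composition and applying
  the corresponding operators in reverse, whichever ascents the sorting uses.
\<close>

inductive seed_orbit :: "nat \<Rightarrow> nat \<Rightarrow> (nat \<Rightarrow> nat) \<Rightarrow> pol \<Rightarrow> bool" for n m where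
  seed: "\<gamma> \<in> compositions n \<Longrightarrow> dominant n \<gamma> \<Longrightarrow> (\<And>a. a \<in> {1..n} \<Longrightarrow> \<gamma> a \<le> m) \<Longrightarrow>
    seed_orbit n m \<gamma> (seed n m \<gamma>)"
| ascent: "ascent n \<gamma> i \<Longrightarrow> seed_orbit n m (swap_at \<gamma> i) p \<Longrightarrow> seed_orbit n m \<gamma> (pi_bar i p)"

lemma graded_cone_seed_orbit:
  assumes "seed_orbit n m \<gamma> p"
  shows "graded_cone n (compositions n) ((-1) ^ size_comp n \<gamma> * p)"
  using assms
proof induction
  case (seed \<gamma>)
  from graded_cone_seed[OF seed, of 0]
  have "graded_cone n (box_compositions n 0 m) ((-1) ^ size_comp n \<gamma> * seed n m \<gamma>)"
    by simp
  then show ?case by (rule graded_cone_mono) (auto simp: box_compositions_def)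
next
  case (ascent \<gamma> i p)
  have range: "1 \<le> i" "i < n" using ascent.hyps by (auto simp: ascent_def)
  from ascent.IH have "graded_cone n (compositions n) (pi_bar i ((-1) ^ size_comp n (swap_at \<gamma> i) * p))"
    using range by (intro graded_cone_pi_bar compositions_swap)
  then show ?case by (simp add: pi_bar_symmetric_mult size_comp_swap[OF range])
qed

text \<open>
  If the first \<open>k\<close> entries of \<open>\<gamma>\<close> are the largest ones, then \<open>k\<close> is never an ascent while \<open>\<gamma>\<close> is
  sorted, so $P_k$ passes through all operators to the seed.
\<close>

lemma seed_orbit_column_factor:
  assumes "seed_orbit n m \<gamma> p" "k \<le> n" "\<And>a b. a \<in> {1..k} \<Longrightarrow> b \<in> {k<..n} \<Longrightarrow> \<gamma> b \<le> \<gamma> a"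
  shows "seed_orbit n (Suc m) (add_prefix k \<gamma>) (column_factor n k * p)"
  using assms(1,3)
proof induction
  case (seed \<gamma>)
  have "seed_orbit n (Suc m) (add_prefix k \<gamma>) (seed n (Suc m) (add_prefix k \<gamma>))"
  proof (rule seed_orbit.seed)
    show "dominant n (add_prefix k \<gamma>)"
      using seed.hyps(2) by (rule dominant_add_prefix)
    show "add_prefix k \<gamma> a \<le> Suc m" if "a \<in> {1..n}" for a
      using seed.hyps(3)[OF that] by (simp add: add_prefix_def)
  qed (use seed.hyps(1) assms(2) compositions_add_prefix in blast)
  then show ?case by (simp only: seed_add_prefix[OF assms(2) seed.hyps(3)])
next
  case (ascent \<gamma> i p)
  have range: "1 \<le> i" "i < n" "\<gamma> i < \<gamma> (Suc i)" using ascent.hyps by (auto simp: ascent_def)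
  have "i \<noteq> k" using ascent.prems[of i "Suc i"] range by force
  have prefix: "add_prefix k (swap_at \<gamma> i) = swap_at (add_prefix k \<gamma>) i"
    using \<open>i \<noteq> k\<close> range by (auto simp: fun_eq_iff add_prefix_def transpose_def)
  have "swap_at \<gamma> i b \<le> swap_at \<gamma> i a" if "a \<in> {1..k}" "b \<in> {k<..n}" for a b
  proof -
    have "transpose i (Suc i) a \<in> {1..k}" "transpose i (Suc i) b \<in> {k<..n}"
      using that \<open>i \<noteq> k\<close> range by (auto simp: transpose_def)
    then show ?thesis using ascent.prems by simp
  qed
  then have "seed_orbit n (Suc m) (swap_at (add_prefix k \<gamma>) i) (column_factor n k * p)"
    using ascent.IH unfolding prefix by blast
  moreover have "ascent n (add_prefix k \<gamma>) i"
    using range \<open>i \<noteq> k\<close> by (auto simp: ascent_def add_prefix_def)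
  ultimately have "seed_orbit n (Suc m) (add_prefix k \<gamma>) (pi_bar i (column_factor n k * p))"
    by (intro seed_orbit.ascent)
  then show ?case
    using range \<open>i \<noteq> k\<close> by (simp add: pi_bar_symmetric_mult swap_vars_column_factor)
qed

section \<open>Lowest degree parts\<close>

lemma tdeg_superset:
  assumes "finite F" "Poly_Mapping.keys t \<subseteq> F"
  shows "tdeg t = (\<Sum>v\<in>F. Poly_Mapping.lookup t v)"
  unfolding tdeg_def using assms by (intro sum.mono_neutral_left) (auto simp: in_keys_iff)

lemma tdeg_add: "tdeg (s + t) = tdeg s + tdeg t"
proof -
  let ?F = "Poly_Mapping.keys s \<union> Poly_Mapping.keys t"
  have "tdeg (s + t) = (\<Sum>v\<in>?F. Poly_Mapping.lookup (s + t) v)"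
    using keys_add[of s t] by (intro tdeg_superset) auto
  moreover have "tdeg s = (\<Sum>v\<in>?F. Poly_Mapping.lookup s v)" by (intro tdeg_superset) auto
  moreover have "tdeg t = (\<Sum>v\<in>?F. Poly_Mapping.lookup t v)" by (intro tdeg_superset) auto
  ultimately show ?thesis by (simp add: lookup_add sum.distrib)
qed

lemma tdeg_single [simp]: "tdeg (Poly_Mapping.single v k) = k"
  by (simp add: tdeg_def)

lemma tdeg_zero [simp]: "tdeg 0 = 0"
  by (simp add: tdeg_def)

lemma tdeg_sum: "tdeg (\<Sum>i\<in>I. f i) = (\<Sum>i\<in>I. tdeg (f i))"
  by (induction I rule: infinite_finite_induct) (simp_all add: tdeg_add)

definition homog :: "nat \<Rightarrow> pol \<Rightarrow> pol" where
  "homog d p = (\<Sum>t\<in>{t \<in> Poly_Mapping.keys p. tdeg t = d}. Poly_Mapping.single t (Poly_Mapping.lookup p t))"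

lemma lookup_homog:
  "Poly_Mapping.lookup (homog d p) t = (if tdeg t = d then Poly_Mapping.lookup p t else 0)"
  unfolding homog_def by (auto simp: lookup_sum lookup_single when_def in_keys_iff)

lemma homog_add: "homog d (p + q) = homog d p + homog d q"
  by (rule poly_mapping_eqI) (simp add: lookup_homog lookup_add)

lemma homog_diff: "homog d (p - q) = homog d p - homog d q"
  by (rule poly_mapping_eqI) (simp add: lookup_homog lookup_minus)

lemma homog_zero [simp]: "homog d 0 = 0"
  by (rule poly_mapping_eqI) (simp add: lookup_homog)

lemma homog_single: "homog d (Poly_Mapping.single t c) = (if tdeg t = d then Poly_Mapping.single t c else 0)"
  by (rule poly_mapping_eqI) (auto simp: lookup_homog lookup_single when_def)

lemma homog_Suc_pvar_mult: "homog (Suc d) (pvar v * p) = pvar v * homog d p"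
  by (induction p rule: mapping_induct)
    (simp_all add: homog_single pvar_def mult_single tdeg_add right_diff_distrib homog_diff)

lemma homog_0_pvar_mult: "homog 0 (pvar v * p) = 0"
  by (induction p rule: mapping_induct)
    (simp_all add: homog_single pvar_def mult_single tdeg_add right_diff_distrib homog_diff)

lemma homog_swap_vars: "homog d (swap_vars i p) = swap_vars i (homog d p)"
proof (induction p rule: mapping_induct)
  case (monomial t)
  define \<sigma> where "\<sigma> v = (case v of XVar a \<Rightarrow> XVar (transpose i (Suc i) a) | YVar j \<Rightarrow> YVar j)" for v
  define s where "s = (\<Sum>v\<in>Poly_Mapping.keys t. Poly_Mapping.single (\<sigma> v) (Poly_Mapping.lookup t v))"
  have \<sigma>: "swap_vars i (pvar v) = pvar (\<sigma> v)" for v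
    by (cases v) (simp_all add: \<sigma>_def)
  have "swap_vars i (Poly_Mapping.single t 1) =
      (\<Prod>v\<in>Poly_Mapping.keys t. pvar (\<sigma> v) ^ Poly_Mapping.lookup t v)"
    by (subst monomial_eq_prod) (simp add: swap.map_simps \<sigma>)
  then have "swap_vars i (Poly_Mapping.single t 1) = Poly_Mapping.single s 1"
    unfolding s_def single_sum_exponents by (simp add: pvar_power)
  moreover have "tdeg s = tdeg t"
    unfolding s_def by (simp add: tdeg_sum tdeg_def[of t])
  ultimately show ?case by (simp add: homog_single swap.map_zero)
qed (simp_all add: swap.map_simps homog_diff)

text \<open>
  Divided differences are homogeneous of degree $-1$: compare components in the defining equation.
\<close>

lemma homog_ddiff: "homog d (ddiff i f) = ddiff i (homog (Suc d) f)"
proof (rule ddiff_eqI[symmetric])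
  have "(xv i - xv (Suc i)) * homog d (ddiff i f) = homog (Suc d) ((xv i - xv (Suc i)) * ddiff i f)"
    by (simp add: left_diff_distrib homog_diff homog_Suc_pvar_mult)
  then show "(xv i - xv (Suc i)) * homog d (ddiff i f) =
      homog (Suc d) f - swap_vars i (homog (Suc d) f)"
    by (simp add: ddiff_eq homog_diff homog_swap_vars)
qed

text \<open>
  The polynomial \<open>g\<close> may be zero here. This makes the notion compatible with all operators; if
  \<open>g\<close> is nonzero, it is the lowest degree part of \<open>f\<close>.
\<close>

definition starts_with :: "nat \<Rightarrow> pol \<Rightarrow> pol \<Rightarrow> bool" where
  "starts_with d f g \<longleftrightarrow> (\<forall>k<d. homog k f = 0) \<and> homog d f = g"

lemma starts_with_pvar_mult:
  "starts_with d f g \<Longrightarrow> starts_with (Suc d) (pvar v * f) (pvar v * g)"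
  unfolding starts_with_def by (auto simp: homog_Suc_pvar_mult less_Suc_eq_0_disj homog_0_pvar_mult)

lemma starts_with_add:
  "starts_with d f g \<Longrightarrow> starts_with d f' g' \<Longrightarrow> starts_with d (f + f') (g + g')"
  unfolding starts_with_def by (auto simp: homog_add)

lemma starts_with_diff_higher:
  "starts_with d f g \<Longrightarrow> starts_with (Suc d) f' g' \<Longrightarrow> starts_with d (f - f') g"
  unfolding starts_with_def by (auto simp: homog_diff less_Suc_eq)

lemma starts_with_sum_minus_prod:
  assumes "starts_with d f g"
  shows "starts_with (Suc d) ((pvar v + pvar w - pvar v * pvar w) * f) ((pvar v + pvar w) * g)"
proof -
  note linear = starts_with_pvar_mult[OF assms]
  from starts_with_diff_higher[OF starts_with_add[OF linear[of v] linear[of w]]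
      starts_with_pvar_mult[OF linear[of w], of v]]
  show ?thesis by (simp add: algebra_simps)
qed

lemma starts_with_one_minus:
  assumes "starts_with d f g"
  shows "starts_with d ((1 - pvar v) * f) g"
  using starts_with_diff_higher[OF assms starts_with_pvar_mult[OF assms, of v]]
  by (simp add: algebra_simps)

lemma starts_with_ddiff:
  assumes "starts_with (Suc d) f g"
  shows "starts_with d (ddiff i f) (ddiff i g)"
proof -
  have "ddiff i 0 = 0" by (rule ddiff_eqI) (simp add: swap.map_zero)
  then show ?thesis using assms by (auto simp: starts_with_def homog_ddiff)
qed

lemma starts_with_pi_bar:
  "starts_with d f g \<Longrightarrow> starts_with d (pi_bar i f) (ddiff i (xv i * g))"
  unfolding pi_bar_conv_ddiff
  by (intro starts_with_ddiff starts_with_one_minus starts_with_pvar_mult)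

lemma starts_with_pi_bar2:
  "starts_with d f g \<Longrightarrow> starts_with d (pi_bar2 i j f) (ddiff i ((xv i + yv j) * g))"
  unfolding pi_bar2_def ddiff_bar_def
  by (intro starts_with_ddiff starts_with_one_minus starts_with_sum_minus_prod)

lemma starts_with_one: "starts_with 0 1 1"
  unfolding starts_with_def
  using homog_single[of 0 "0 :: var \<Rightarrow>\<^sub>0 nat" 1] by simp

lemma starts_with_prod_mult:
  assumes "finite I" "starts_with d f g"
    and "\<And>i d f g. i \<in> I \<Longrightarrow> starts_with d f g \<Longrightarrow> starts_with (d + e i) (F i * f) (G i * g)"
  shows "starts_with (d + (\<Sum>i\<in>I. e i)) ((\<Prod>i\<in>I. F i) * f) ((\<Prod>i\<in>I. G i) * g)"
  using assms(1,3)
proof (induction I rule: finite_induct)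
  case (insert i I)
  then have "starts_with (d + (\<Sum>i\<in>I. e i) + e i) (F i * ((\<Prod>i\<in>I. F i) * f)) (G i * ((\<Prod>i\<in>I. G i) * g))"
    by blast
  then show ?case using insert.hyps by (simp add: algebra_simps)
qed (simp add: assms(2))

lemma starts_with_omega_bar:
  assumes "finite M" "starts_with d f g"
  shows "\<exists>e. starts_with e (omega_bar i M * f)
    ((\<Prod>a\<in>{1..i}. \<Prod>m\<in>M. xv a + yv (int m)) * g)"
  unfolding omega_bar_def
  by (rule exI, rule starts_with_prod_mult[where e = "\<lambda>_. \<Sum>m\<in>M. 1"], simp, rule assms(2),
      rule starts_with_prod_mult, rule assms(1), assumption)
    (simp add: starts_with_sum_minus_prod)

lemma lowest_part_starts_with:
  assumes "starts_with d f g" "g \<noteq> 0"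
  shows "f \<noteq> 0" "low_deg f = d" "lowest_part f = g"
proof -
  have below: "homog k f = 0" if "k < d" for k
    using assms(1) that by (simp add: starts_with_def)
  have g: "homog d f = g" using assms(1) by (simp add: starts_with_def)
  then obtain t where t: "t \<in> Poly_Mapping.keys f" "tdeg t = d"
    using assms(2) by (metis (mono_tags, lifting) homog_def mem_Collect_eq sum.neutral)
  then show "f \<noteq> 0" by auto
  have "d \<le> tdeg s" if "s \<in> Poly_Mapping.keys f" for s
  proof (rule ccontr)
    assume "\<not> d \<le> tdeg s"
    then have "Poly_Mapping.lookup (homog (tdeg s) f) s = 0" using below by simp
    then show False using that by (simp add: lookup_homog in_keys_iff)
  qed
  then show d: "low_deg f = d"
    unfolding low_deg_def using t by (intro Min_eqI) auto
  show "lowest_part f = g"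
    using g unfolding lowest_part_def homog_def d .
qed

lemma starts_with_seed:
  "starts_with (size_comp n \<nu>) (seed n m \<nu>) (x_monomial n \<nu>)"
proof -
  have "starts_with (d + \<nu> a) (xv a ^ \<nu> a * (1 - xv a) ^ (m - \<nu> a) * f) (xv a ^ \<nu> a * g)"
    if "starts_with d f g" for d f g a
  proof -
    have "starts_with d ((1 - xv a) ^ k * f) g" for k
      using that by (induction k) (simp_all add: mult.assoc starts_with_one_minus)
    moreover have "starts_with (d + k) (xv a ^ k * f) (xv a ^ k * g)" if "starts_with d f g" for k f
      using that by (induction k) (simp_all add: mult.assoc starts_with_pvar_mult)
    ultimately show ?thesis by (simp add: mult.assoc)
  qed
  then have "starts_with (0 + (\<Sum>a\<in>{1..n}. \<nu> a))
    ((\<Prod>a\<in>{1..n}. xv a ^ \<nu> a * (1 - xv a) ^ (m - \<nu> a)) * 1) ((\<Prod>a\<in>{1..n}. xv a ^ \<nu> a) * 1)"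
    by (intro starts_with_prod_mult starts_with_one) auto
  then show ?thesis by (simp add: size_comp_def seed_def x_monomial_def)
qed

section \<open>Antisymmetrization\<close>

definition permute_vars :: "(nat \<Rightarrow> nat) \<Rightarrow> pol \<Rightarrow> pol" where
  "permute_vars \<sigma> = subst_pol (\<lambda>v. case v of XVar a \<Rightarrow> xv (\<sigma> a) | YVar j \<Rightarrow> yv j)"

interpretation permute: ring_map "permute_vars \<sigma>" for \<sigma>
  unfolding permute_vars_def by (rule ring_map_subst_pol)

lemma permute_vars_xv [simp]: "permute_vars \<sigma> (xv a) = xv (\<sigma> a)"
  by (simp add: permute_vars_def)

lemma permute_vars_swap_vars:
  "permute_vars \<sigma> (swap_vars i p) = permute_vars (\<sigma> \<circ> transpose i (Suc i)) p"
proof (rule ring_map_unique[of "\<lambda>p. permute_vars \<sigma> (swap_vars i p)"])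
  show "permute_vars \<sigma> (swap_vars i (pvar v)) = permute_vars (\<sigma> \<circ> transpose i (Suc i)) (pvar v)" for v
    by (cases v) (simp_all add: permute_vars_def)
qed (rule ring_map_comp[OF swap.ring_map_axioms permute.ring_map_axioms] permute.ring_map_axioms)+

definition antisymmetrize :: "nat \<Rightarrow> pol \<Rightarrow> pol" where
  "antisymmetrize n p = (\<Sum>\<sigma>\<in>{\<sigma>. \<sigma> permutes {1..n}}. of_int (sign \<sigma>) * permute_vars \<sigma> p)"

lemma antisymmetrize_diff: "antisymmetrize n (p - q) = antisymmetrize n p - antisymmetrize n q"
  unfolding antisymmetrize_def by (simp add: permute.map_diff right_diff_distrib sum_subtractf)

lemma antisymmetrize_swap_vars:
  assumes "1 \<le> i" "i < n"
  shows "antisymmetrize n (swap_vars i p) = - antisymmetrize n p"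
proof -
  let ?\<tau> = "transpose i (Suc i)"
  have \<tau>: "?\<tau> permutes {1..n}" using assms by (intro permutes_swap_id) auto
  have sgn: "sign (\<sigma> \<circ> ?\<tau>) = - sign \<sigma>" if "\<sigma> permutes {1..n}" for \<sigma>
    using that \<tau> permutation_permutes[of \<sigma>] permutation_permutes[of ?\<tau>]
    by (metis finite_atLeastAtMost mult.right_neutral mult_minus_right n_not_Suc_n sign_compose sign_swap_id)
  have "- antisymmetrize n p = - (\<Sum>\<sigma>\<in>{\<sigma>. \<sigma> permutes {1..n}}. of_int (sign (\<sigma> \<circ> ?\<tau>)) * permute_vars (\<sigma> \<circ> ?\<tau>) p)"
    unfolding antisymmetrize_def by (subst sum_permutations_compose_right[OF \<tau>]) (rule refl)
  also have "\<dots> = antisymmetrize n (swap_vars i p)"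
    unfolding antisymmetrize_def by (simp add: permute_vars_swap_vars sgn sum_negf[symmetric])
  finally show ?thesis ..
qed

definition staircase :: "nat \<Rightarrow> pol" where
  "staircase n = x_monomial n (\<lambda>a. n - a)"

text \<open>
  Let \<open>h\<close> be $x_1^{n-1} \cdots x_n^0 / x_i$, which is symmetric in $x_i, x_{i+1}$, and let
  $G = \partial_i(x_i g)$, which is symmetric as well. Then the antisymmetrization of $h x_i G$ is half of
  that of $h (x_i - x_{i+1}) G = h x_i g - s_i(h x_i g)$, which is twice that of $h x_i g$.
\<close>

lemma antisymmetrize_demazure:
  assumes "1 \<le> i" "i < n"
  shows "antisymmetrize n (staircase n * ddiff i (xv i * g)) = antisymmetrize n (staircase n * g)"
proof -
  define \<beta> where "\<beta> = (\<lambda>a. n - a)(i := n - Suc i)"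
  define h where "h = x_monomial n \<beta>"
  have sym: "swap_vars i h = h"
    unfolding h_def using assms by (intro swap_vars_x_monomial) (auto simp: \<beta>_def)
  have "\<beta>(i := Suc (\<beta> i)) = (\<lambda>a. n - a)"
    using assms by (auto simp: \<beta>_def fun_eq_iff)
  then have w: "staircase n = xv i * h"
    unfolding staircase_def h_def using x_monomial_increment[of i n \<beta>] assms by simp
  let ?A = "antisymmetrize n" and ?G = "ddiff i (xv i * g)"
  have yG: "?A (h * xv (Suc i) * ?G) = - ?A (h * xv i * ?G)"
    using antisymmetrize_swap_vars[OF assms, of "h * xv i * ?G"] by (simp add: swap.map_mult sym)
  have yg: "?A (h * xv (Suc i) * swap_vars i g) = - ?A (h * xv i * g)"
    using antisymmetrize_swap_vars[OF assms, of "h * xv i * g"] by (simp add: swap.map_mult sym)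
  have "2 * ?A (h * xv i * ?G) = ?A (h * xv i * ?G) - ?A (h * xv (Suc i) * ?G)"
    by (simp add: yG)
  also have "\<dots> = ?A (h * ((xv i - xv (Suc i)) * ?G))"
    by (simp add: antisymmetrize_diff[symmetric] algebra_simps)
  also have "\<dots> = ?A (h * xv i * g - h * xv (Suc i) * swap_vars i g)"
    unfolding ddiff_eq by (simp add: swap.map_mult algebra_simps)
  also have "\<dots> = 2 * ?A (h * xv i * g)"
    by (simp add: antisymmetrize_diff yg)
  finally show ?thesis by (simp add: w mult.commute)
qed

definition x_exponent :: "nat \<Rightarrow> (nat \<Rightarrow> nat) \<Rightarrow> (var \<Rightarrow>\<^sub>0 nat)" where
  "x_exponent n e = (\<Sum>a\<in>{1..n}. Poly_Mapping.single (XVar a) (e a))"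

lemma x_monomial_conv_single: "x_monomial n e = Poly_Mapping.single (x_exponent n e) 1"
  unfolding x_monomial_def x_exponent_def single_sum_exponents by (simp add: pvar_power)

lemma lookup_x_exponent: "Poly_Mapping.lookup (x_exponent n e) (XVar a) = (if a \<in> {1..n} then e a else 0)"
  by (simp add: x_exponent_def lookup_sum lookup_single when_def)

lemma x_exponent_eqD: "x_exponent n e = x_exponent n e' \<Longrightarrow> a \<in> {1..n} \<Longrightarrow> e a = e' a"
  by (metis lookup_x_exponent)

lemma permute_vars_x_monomial:
  assumes "\<sigma> permutes {1..n}"
  shows "permute_vars \<sigma> (x_monomial n e) = x_monomial n (e \<circ> inv \<sigma>)"
proof -
  have "permute_vars \<sigma> (x_monomial n e) = (\<Prod>a\<in>{1..n}. xv (\<sigma> a) ^ e a)"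
    by (simp add: x_monomial_def permute.map_simps)
  also have "\<dots> = x_monomial n (e \<circ> inv \<sigma>)"
    unfolding x_monomial_def
    by (rule prod.reindex_bij_witness[of _ "inv \<sigma>" \<sigma>])
      (use assms permutes_in_image[OF assms] permutes_in_image[OF permutes_inv[OF assms]] in
        \<open>simp_all add: permutes_inverses\<close>)
  finally show ?thesis .
qed

lemma lookup_of_int_mult:
  fixes p :: "'k::comm_monoid_add \<Rightarrow>\<^sub>0 int"
  shows "Poly_Mapping.lookup (of_int c * p) t = c * Poly_Mapping.lookup p t"
  by (induction c rule: int_induct[of _ 0])
    (simp_all add: distrib_right left_diff_distrib lookup_add lookup_minus)

text \<open>
  With distinct exponents, only the identity permutation fixes the monomial, so its coefficient in the
  alternating sum is 1.
\<close>

lemma antisymmetrize_strict_monomial_nonzero: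
  assumes "inj_on e {1..n}"
  shows "antisymmetrize n (x_monomial n e) \<noteq> 0"
proof -
  have "(if x_exponent n (e \<circ> inv \<sigma>) = x_exponent n e then 1 else 0) = (if \<sigma> = id then 1 else (0::int))"
    if \<sigma>: "\<sigma> permutes {1..n}" for \<sigma>
  proof -
    have "\<sigma> = id" if eq: "x_exponent n (e \<circ> inv \<sigma>) = x_exponent n e"
    proof -
      have "inv \<sigma> a = a" for a
      proof (cases "a \<in> {1..n}")
        case True
        then have "e (inv \<sigma> a) = e a" using x_exponent_eqD[OF eq True] by simp
        moreover have "inv \<sigma> a \<in> {1..n}" using permutes_in_image[OF permutes_inv[OF \<sigma>]] True by blast
        ultimately show ?thesis using assms True by (auto dest: inj_onD)
      next
        case False
        then show ?thesis using permutes_inv[OF \<sigma>] by (meson permutes_not_in)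
      qed
      then show ?thesis using permutes_inverses[OF \<sigma>] by (metis eq_id_iff)
    qed
    then show ?thesis by auto
  qed
  note delta = this
  have coeff: "Poly_Mapping.lookup (permute_vars \<sigma> (x_monomial n e)) (x_exponent n e) =
      (if x_exponent n (e \<circ> inv \<sigma>) = x_exponent n e then 1 else 0)" if "\<sigma> permutes {1..n}" for \<sigma>
    unfolding permute_vars_x_monomial[OF that] unfolding x_monomial_conv_single
    by (simp add: lookup_single when_def)
  have "Poly_Mapping.lookup (antisymmetrize n (x_monomial n e)) (x_exponent n e) =
    (\<Sum>\<sigma>\<in>{\<sigma>. \<sigma> permutes {1..n}}. sign \<sigma> * (if x_exponent n (e \<circ> inv \<sigma>) = x_exponent n e then 1 else 0))"
    unfolding antisymmetrize_def lookup_sum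
    by (intro sum.cong) (simp_all add: lookup_of_int_mult coeff)
  also have "\<dots> = (\<Sum>\<sigma>\<in>{\<sigma>. \<sigma> permutes {1..n}}. if \<sigma> = id then 1 else 0)"
    by (intro sum.cong) (use delta in auto)
  also have "\<dots> = 1" by (simp add: finite_permutations permutes_id)
  finally show ?thesis by auto
qed

text \<open>
  The lowest degree part of a seed is $x^\nu$, and that of an orbit element arises from it by Demazure
  operators $g \mapsto \partial_i(x_i g)$. None of them changes the antisymmetrization of
  $x_1^{n-1} \cdots x_n^0 g$, which at the start is an alternant with strictly decreasing exponents.
\<close>

lemma seed_orbit_lowest_part:
  assumes "seed_orbit n m \<gamma> p"
  shows "\<exists>g. starts_with (size_comp n \<gamma>) p g \<and> g \<noteq> 0"
proof -
  have "\<exists>g. starts_with (size_comp n \<gamma>) p g \<and> antisymmetrize n (staircase n * g) \<noteq> 0"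
    using assms
  proof induction
    case (seed \<gamma>)
    have "n - b + \<gamma> b < n - a + \<gamma> a" if "a < b" "a \<in> {1..n}" "b \<in> {1..n}" for a b
      using dominantD[OF seed(2), of a b] that by auto
    then have "inj_on (\<lambda>a. n - a + \<gamma> a) {1..n}"
      by (intro linorder_inj_onI') (metis less_irrefl)
    then have "antisymmetrize n (x_monomial n (\<lambda>a. n - a + \<gamma> a)) \<noteq> 0"
      by (rule antisymmetrize_strict_monomial_nonzero)
    moreover have "staircase n * x_monomial n \<gamma> = x_monomial n (\<lambda>a. n - a + \<gamma> a)"
      unfolding staircase_def x_monomial_def power_add prod.distrib ..
    ultimately show ?case using starts_with_seed by metis
  next
    case (ascent \<gamma> i p)
    then have range: "1 \<le> i" "i < n" by (auto simp: ascent_def)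
    from ascent.IH obtain g where g: "starts_with (size_comp n (swap_at \<gamma> i)) p g"
      "antisymmetrize n (staircase n * g) \<noteq> 0" by blast
    from starts_with_pi_bar[OF g(1), of i] g(2) show ?case
      using antisymmetrize_demazure[OF range, of g] size_comp_swap[OF range, of \<gamma>] by metis
  qed
  moreover have "antisymmetrize n 0 = 0"
    using antisymmetrize_diff[of n 0 0] by simp
  ultimately show ?thesis by (metis mult_zero_right)
qed

section \<open>The specialization\<close>

interpretation laurent: ring_map to_laurent
  unfolding to_laurent_def by (rule ring_map_subst_pol)

interpretation spec: ring_map "reverse_inverse_spec n" for n
  unfolding reverse_inverse_spec_def by (rule ring_map_subst_pol)

lemma to_laurent_pvar [simp]: "to_laurent (pvar v) = LVar v 1"
  by (simp add: to_laurent_def)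

lemma spec_xv [simp]: "reverse_inverse_spec n (xv a) = LVar (XVar (n + 1 - a)) (-1)"
  by (simp add: reverse_inverse_spec_def)

lemma spec_yv [simp]: "reverse_inverse_spec n (yv j) = -1"
  by (simp add: reverse_inverse_spec_def)

lemma LVar_inverse [simp]: "LVar v 1 * LVar v (-1) = 1" "LVar v (-1) * LVar v 1 = 1"
  by (simp_all add: LVar_def mult_single single_add[symmetric])

lemma LVar_eq_iff: "LVar v 1 = LVar w 1 \<longleftrightarrow> v = w"
proof -
  have "Poly_Mapping.single v (1::int) = Poly_Mapping.single w 1 \<Longrightarrow> v = w"
    by (metis keys_single one_neq_zero singleton_inject)
  then show ?thesis by (auto simp: LVar_def frag_of_eq)
qed

lemma to_laurent_eq_0D:
  assumes "to_laurent p = 0"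
  shows "p = 0"
proof (rule poly_mapping_eqI)
  fix s
  define \<iota> :: "(var \<Rightarrow>\<^sub>0 nat) \<Rightarrow> (var \<Rightarrow>\<^sub>0 int)" where
    "\<iota> t = (\<Sum>v\<in>Poly_Mapping.keys t. Poly_Mapping.single v (int (Poly_Mapping.lookup t v)))" for t
  have lookup_\<iota>: "Poly_Mapping.lookup (\<iota> t) v = int (Poly_Mapping.lookup t v)" for t v
    by (auto simp: \<iota>_def lookup_sum lookup_single when_def in_keys_iff)
  have inj: "\<iota> s = \<iota> t \<longleftrightarrow> s = t" for t
    by (metis lookup_\<iota> of_nat_eq_iff poly_mapping_eqI)
  have power: "LVar v 1 ^ k = Poly_Mapping.single (Poly_Mapping.single v (int k)) 1" for v k
    by (induction k) (simp_all add: LVar_def mult_single flip: single_add)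
  have "to_laurent p = (\<Sum>t\<in>Poly_Mapping.keys p. of_int (Poly_Mapping.lookup p t) * Poly_Mapping.single (\<iota> t) 1)"
    unfolding to_laurent_def subst_pol_def \<iota>_def single_sum_exponents power ..
  then have "Poly_Mapping.lookup (to_laurent p) (\<iota> s) =
      (\<Sum>t\<in>Poly_Mapping.keys p. if s = t then Poly_Mapping.lookup p t else 0)"
    by (simp add: lookup_sum lookup_of_int_mult lookup_single when_def inj if_distrib cong: if_cong)
  also have "\<dots> = Poly_Mapping.lookup p s"
    by (simp add: in_keys_iff)
  finally show "Poly_Mapping.lookup p s = Poly_Mapping.lookup 0 s" using assms by simp
qed

text \<open>
  The exchange of two variables on Laurent polynomials, needed because
  $x_i \mapsto x_{n+1-i}^{-1}$ carries $s_i$ to $s_{n-i}$ on the other side.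
\<close>

definition swap_laurent :: "nat \<Rightarrow> laurent \<Rightarrow> laurent" where
  "swap_laurent i = monomial_ext (\<lambda>t. Poly_Mapping.single (Poly_Mapping.map_key
     (\<lambda>v. case v of XVar a \<Rightarrow> XVar (transpose i (Suc i) a) | YVar j \<Rightarrow> YVar j) t) 1)"

lemma inj_swap_index: "inj (\<lambda>v. case v of XVar a \<Rightarrow> XVar (transpose i (Suc i) a) | YVar j \<Rightarrow> YVar j)"
  by (rule injI) (auto split: var.splits dest: transpose_eq_imp_eq)

interpretation swapl: ring_map "swap_laurent i" for i
  unfolding swap_laurent_def
  by (rule ring_map_monomial_ext)
    (simp_all add: map_key_plus[OF inj_swap_index] map_key_zero[OF inj_swap_index] single_add_exponents)

lemma swap_laurent_LVar_XVar [simp]: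
  "swap_laurent i (LVar (XVar a) e) = LVar (XVar (transpose i (Suc i) a)) e"
proof -
  have "Poly_Mapping.single (XVar a) e = Poly_Mapping.single
      (case XVar (transpose i (Suc i) a) of XVar a \<Rightarrow> XVar (transpose i (Suc i) a) | YVar j \<Rightarrow> YVar j) e"
    by simp
  then show ?thesis
    unfolding swap_laurent_def LVar_def monomial_ext_single
    by (simp only: map_key_single[OF inj_swap_index]) simp
qed

lemma swap_laurent_LVar_YVar [simp]: "swap_laurent i (LVar (YVar j) e) = LVar (YVar j) e"
proof -
  have "Poly_Mapping.single (YVar j) e = Poly_Mapping.single
      (case YVar j of XVar a \<Rightarrow> XVar (transpose i (Suc i) a) | YVar j \<Rightarrow> YVar j) e"
    by simp
  then show ?thesis
    unfolding swap_laurent_def LVar_def monomial_ext_single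
    by (simp only: map_key_single[OF inj_swap_index]) simp
qed

lemma swap_laurent_to_laurent: "swap_laurent i (to_laurent p) = to_laurent (swap_vars i p)"
proof (rule ring_map_unique[of "\<lambda>p. swap_laurent i (to_laurent p)" "\<lambda>p. to_laurent (swap_vars i p)"])
  show "swap_laurent i (to_laurent (pvar v)) = to_laurent (swap_vars i (pvar v))" for v
    by (cases v) simp_all
qed (rule ring_map_comp[OF laurent.ring_map_axioms swapl.ring_map_axioms]
    ring_map_comp[OF swap.ring_map_axioms laurent.ring_map_axioms])+

lemma swap_laurent_spec:
  assumes "1 \<le> i" "i < n"
  shows "swap_laurent (n - i) (reverse_inverse_spec n p) = reverse_inverse_spec n (swap_vars i p)"
proof (rule ring_map_unique[of "\<lambda>p. swap_laurent (n - i) (reverse_inverse_spec n p)"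
      "\<lambda>p. reverse_inverse_spec n (swap_vars i p)"])
  fix v
  show "swap_laurent (n - i) (reverse_inverse_spec n (pvar v)) = reverse_inverse_spec n (swap_vars i (pvar v))"
  proof (cases v)
    case (XVar a)
    have "transpose (n - i) (Suc (n - i)) (n + 1 - a) = n + 1 - transpose i (Suc i) a"
      using assms by (auto simp: transpose_def)
    then show ?thesis using XVar by simp
  qed (simp add: swapl.map_simps)
qed (rule ring_map_comp[OF spec.ring_map_axioms swapl.ring_map_axioms]
    ring_map_comp[OF swap.ring_map_axioms spec.ring_map_axioms])+

text \<open>
  The polynomial \<open>p\<close> is the reversed, inverted and specialized \<open>g\<close> with denominators cleared by the
  \<open>c\<close>-th power of $x_1 \cdots x_n$. The exponent \<open>c\<close> counts nonempty columns, each of which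
  contributes at most one power of any $x_i^{-1}$.
\<close>

definition transforms_to :: "nat \<Rightarrow> nat \<Rightarrow> pol \<Rightarrow> pol \<Rightarrow> bool" where
  "transforms_to n c g p \<longleftrightarrow>
    to_laurent p = to_laurent (\<Prod>i\<in>{1..n}. xv i) ^ c * reverse_inverse_spec n g"

lemma transforms_to_swap_vars:
  assumes "transforms_to n c g p" "1 \<le> i" "i < n"
  shows "transforms_to n c (swap_vars i g) (swap_vars (n - i) p)"
proof -
  have "swap_vars (n - i) (\<Prod>i\<in>{1..n}. xv i) = (\<Prod>i\<in>{1..n}. xv i)"
    using assms by (intro swap_vars_prod_symmetric) (auto simp: transpose_def)
  then show ?thesis
    using assms(1) unfolding transforms_to_def
    by (metis swap_laurent_to_laurent swap_laurent_spec[OF assms(2,3)] swapl.map_mult swapl.map_power)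
qed

text \<open>
  With $X = x_{n-i}$ and $Y = x_{n+1-i}$, the left side is a divided difference in $Y^{-1}, X^{-1}$ with
  factor $Y^{-1} - 1$. Multiplying numerator and denominator by $X Y$ turns the denominator
  $Y^{-1} - X^{-1}$ into $X - Y$ and the coefficients $Y^{-1} - 1$ and $X^{-1} - 1$ into $X (1 - Y)$
  and $Y (1 - X)$, the coefficients of $\overline\pi_{n-i}$.
\<close>

lemma transforms_to_ddiff:
  assumes "transforms_to n c g p" "1 \<le> i" "i < n"
  shows "transforms_to n c (ddiff i ((xv i + yv j) * g)) (pi_bar (n - i) p)"
proof -
  let ?k = "n - i" and ?G = "ddiff i ((xv i + yv j) * g)"
  let ?\<Psi> = "reverse_inverse_spec n" and ?E = "to_laurent (\<Prod>i\<in>{1..n}. xv i) ^ c"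
  define X Y X' Y' where "X = LVar (XVar ?k) 1" "Y = LVar (XVar (Suc ?k)) 1"
    "X' = LVar (XVar ?k) (-1)" "Y' = LVar (XVar (Suc ?k)) (-1)"
  note XY = this
  have inverses: "X * X' = 1" "Y * Y' = 1" by (simp_all add: XY)
  have vars: "?\<Psi> (xv i) = Y'" "?\<Psi> (xv (Suc i)) = X'" "to_laurent (xv ?k) = X" "to_laurent (xv (Suc ?k)) = Y"
    using assms by (simp_all add: XY Suc_diff_le)
  have "?\<Psi> ((xv i - xv (Suc i)) * ?G) = ?\<Psi> ((xv i + yv j) * g - swap_vars i ((xv i + yv j) * g))"
    by (simp only: ddiff_eq)
  then have "(Y' - X') * ?\<Psi> ?G = (Y' - 1) * ?\<Psi> g - (X' - 1) * ?\<Psi> (swap_vars i g)"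
    by (simp only: spec.map_simps swap.map_simps swap_vars_xv transpose_apply_first swap_vars_yv vars spec_yv) simp
  then have "X * Y * ((Y' - X') * ?\<Psi> ?G) = X * Y * ((Y' - 1) * ?\<Psi> g - (X' - 1) * ?\<Psi> (swap_vars i g))"
    by simp
  then have "(X - Y) * ?\<Psi> ?G = X * (1 - Y) * ?\<Psi> g - Y * (1 - X) * ?\<Psi> (swap_vars i g)"
    using inverses by algebra
  then have "?E * ((X - Y) * ?\<Psi> ?G) = ?E * (X * (1 - Y) * ?\<Psi> g - Y * (1 - X) * ?\<Psi> (swap_vars i g))"
    by simp
  also have "\<dots> = X * (1 - Y) * (?E * ?\<Psi> g) - Y * (1 - X) * (?E * ?\<Psi> (swap_vars i g))"
    by (simp add: algebra_simps)
  also have "\<dots> = X * (1 - Y) * to_laurent p - Y * (1 - X) * to_laurent (swap_vars ?k p)"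
    using assms(1) transforms_to_swap_vars[OF assms] by (simp add: transforms_to_def)
  also have "\<dots> = to_laurent ((xv ?k - xv (Suc ?k)) * pi_bar ?k p)"
    by (simp only: pi_bar_eq laurent.map_simps vars)
  also have "\<dots> = (X - Y) * to_laurent (pi_bar ?k p)"
    by (simp only: laurent.map_simps vars)
  finally have "(X - Y) * to_laurent (pi_bar ?k p) = (X - Y) * (?E * ?\<Psi> ?G)"
    by (simp add: algebra_simps)
  moreover have "X - Y \<noteq> 0" by (simp add: XY LVar_eq_iff)
  ultimately show ?thesis by (simp add: transforms_to_def)
qed

lemma to_laurent_column_factor:
  assumes "i \<le> n"
  shows "to_laurent (column_factor n (n - i)) =
    to_laurent (\<Prod>a\<in>{1..n}. xv a) * (\<Prod>a\<in>{1..i}. LVar (XVar (n + 1 - a)) (-1) - 1)"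
proof -
  have split: "{1..n} = {1..n - i} \<union> {n - i<..n}" "{1..n - i} \<inter> {n - i<..n} = {}" using assms by auto
  have "(\<Prod>a\<in>{1..i}. LVar (XVar (n + 1 - a)) (-1) - 1) = (\<Prod>b\<in>{n - i<..n}. LVar (XVar b) (-1) - 1)"
    by (rule prod.reindex_bij_witness[of _ "\<lambda>b. n + 1 - b" "\<lambda>a. n + 1 - a"]) (use assms in auto)
  then have "to_laurent (\<Prod>a\<in>{1..n}. xv a) * (\<Prod>a\<in>{1..i}. LVar (XVar (n + 1 - a)) (-1) - 1) =
    (\<Prod>b\<in>{1..n - i}. LVar (XVar b) 1) *
    (\<Prod>b\<in>{n - i<..n}. LVar (XVar b) 1 * (LVar (XVar b) (-1) - 1))"
    unfolding split(1) by (subst prod.union_disjoint)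
      (use split(2) in \<open>auto simp: laurent.map_simps prod.distrib mult.assoc\<close>)
  then show ?thesis
    by (simp add: column_factor_def one_minus_tail_def laurent.map_simps right_diff_distrib)
qed

lemma transforms_to_omega:
  assumes "transforms_to n c g p" "i \<le> n"
  shows "transforms_to n (c + card M) ((\<Prod>a\<in>{1..i}. \<Prod>m\<in>M. xv a + yv (int m)) * g)
    (column_factor n (n - i) ^ card M * p)"
proof -
  have "reverse_inverse_spec n (\<Prod>a\<in>{1..i}. \<Prod>m\<in>M. xv a + yv (int m)) =
      (\<Prod>a\<in>{1..i}. LVar (XVar (n + 1 - a)) (-1) - 1) ^ card M"
    by (simp add: spec.map_simps prod_power_distrib)
  then show ?thesis
    using assms unfolding transforms_to_def
    by (simp add: laurent.map_mult laurent.map_power spec.map_mult to_laurent_column_factor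
        power_mult_distrib power_add ac_simps)
qed

section \<open>Diagrams with nested columns\<close>

definition nested_diagram :: "nat \<Rightarrow> diagram \<Rightarrow> bool" where
  "nested_diagram n E \<longleftrightarrow> finite E \<and> E \<subseteq> {1..n} \<times> UNIV \<and>
    (\<forall>j j'. col E j \<subseteq> col E j' \<or> col E j' \<subseteq> col E j)"

definition row_size :: "diagram \<Rightarrow> nat \<Rightarrow> nat" where
  "row_size E b = card {j. (b, j) \<in> E}"

definition col_count :: "diagram \<Rightarrow> nat" where
  "col_count E = card {j. col E j \<noteq> {}}"

text \<open>
  Inverting the variables replaces row sizes by their complements, and reversing them reads the rows
  from the bottom. Thus ascents of the row sizes at \<open>i\<close> become ascents at $n - i$.
\<close>

definition complement_rows :: "nat \<Rightarrow> diagram \<Rightarrow> nat \<Rightarrow> nat" where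
  "complement_rows n E = (\<lambda>a\<in>{1..n}. col_count E - row_size E (n + 1 - a))"

lemma complement_rows_compositions: "complement_rows n E \<in> compositions n"
  by (simp add: complement_rows_def compositions_def)

lemma finite_nonempty_cols: "finite E \<Longrightarrow> finite {j. col E j \<noteq> {}}"
  by (rule finite_subset[of _ "snd ` E"]) (force simp: col_def)+

lemma finite_row: "finite E \<Longrightarrow> finite {j. (b, j) \<in> E}"
  by (rule finite_subset[of _ "snd ` E"]) force+

lemma row_size_le_col_count: "finite E \<Longrightarrow> row_size E b \<le> col_count E"
  unfolding row_size_def col_count_def
  by (intro card_mono finite_nonempty_cols) (auto simp: col_def)

lemma mem_swap_rows: "(a, j) \<in> swap_rows i E \<longleftrightarrow> (transpose i (Suc i) a, j) \<in> E"
proof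
  assume "(transpose i (Suc i) a, j) \<in> E"
  then show "(a, j) \<in> swap_rows i E"
    unfolding swap_rows_def by (intro image_eqI[of _ _ "(transpose i (Suc i) a, j)"]) auto
qed (auto simp: swap_rows_def)

lemma col_swap_rows: "col (swap_rows i E) j = transpose i (Suc i) ` col E j"
proof -
  have "a \<in> col (swap_rows i E) j \<longleftrightarrow> a \<in> transpose i (Suc i) ` col E j" for a
    unfolding col_def mem_swap_rows mem_Collect_eq
    by (metis (no_types, lifting) image_iff mem_Collect_eq transpose_involutory)
  then show ?thesis by blast
qed

lemma col_empty_cols: "col (empty_cols J E) j = (if j \<in> J then {} else col E j)"
  by (auto simp: col_def empty_cols_def)

lemma row_size_swap_rows: "row_size (swap_rows i E) = row_size E \<circ> transpose i (Suc i)"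
  by (rule ext) (simp add: row_size_def mem_swap_rows)

lemma col_count_swap_rows: "col_count (swap_rows i E) = col_count E"
  by (simp add: col_count_def col_swap_rows)

lemma nested_diagram_swap_rows:
  assumes "nested_diagram n E" "1 \<le> i" "i < n"
  shows "nested_diagram n (swap_rows i E)"
proof -
  have "swap_rows i E \<subseteq> {1..n} \<times> UNIV"
    using assms unfolding swap_rows_def nested_diagram_def by (force simp: transpose_def)
  moreover have "finite (swap_rows i E)"
    using assms unfolding swap_rows_def nested_diagram_def by simp
  ultimately show ?thesis
    using assms(1) unfolding nested_diagram_def col_swap_rows by (metis image_mono)
qed

lemma nested_diagram_empty_cols:
  assumes "nested_diagram n E"
  shows "nested_diagram n (empty_cols J E)"
proof -
  have "empty_cols J E \<subseteq> E" by (auto simp: empty_cols_def)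
  then show ?thesis
    using assms unfolding nested_diagram_def col_empty_cols by (auto intro: finite_subset)
qed

text \<open>
  For nested columns, a single column that contains row $i + 1$ but not row $i$ decides the order of
  the two rows: a column with row $i$ cannot be contained in it, hence contains it.
\<close>

lemma nested_rows_ascent:
  assumes "nested_diagram n E" "1 \<le> i" "i \<notin> col E j" "Suc i \<in> col E j"
  shows "ascent n (row_size E) i"
proof -
  have "{j. (i, j) \<in> E} \<subset> {j. (Suc i, j) \<in> E}"
    using assms unfolding nested_diagram_def col_def by blast
  then have "row_size E i < row_size E (Suc i)"
    unfolding row_size_def using assms(1) by (intro psubset_card_mono finite_row) (simp add: nested_diagram_def)
  moreover have "i < n" using assms by (force simp: nested_diagram_def col_def)
  ultimately show ?thesis using assms(2) by (simp add: ascent_def)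
qed

text \<open>
  The invariant of the orthodontic recursion, for the polynomial \<open>G\<close> computed from the diagram \<open>E\<close>.
  Here \<open>g\<close> is the formal lowest degree part of \<open>G\<close>, its degree \<open>d\<close> being determined by the recursion,
  and \<open>p\<close> is its transform.
\<close>

definition realizes :: "nat \<Rightarrow> diagram \<Rightarrow> pol \<Rightarrow> bool" where
  "realizes n E G \<longleftrightarrow> (\<exists>d g p. starts_with d G g \<and> transforms_to n (col_count E) g p \<and>
     seed_orbit n (col_count E) (complement_rows n E) p)"

lemma realizes_empty: "realizes n {} 1"
proof -
  have "col_count {} = 0" by (simp add: col_count_def col_def)
  moreover have "seed_orbit n 0 (complement_rows n {}) (seed n 0 (complement_rows n {}))"
    by (rule seed_orbit.seed[OF complement_rows_compositions])
      (auto simp: complement_rows_def ascent_def col_count_def col_def)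
  moreover have "seed n 0 (complement_rows n {}) = 1"
    unfolding seed_def by (rule prod.neutral) (simp add: complement_rows_def col_count_def col_def)
  moreover have "transforms_to n 0 1 1"
    by (simp add: transforms_to_def laurent.map_one spec.map_one)
  ultimately show ?thesis unfolding realizes_def using starts_with_one by metis
qed

lemma realizes_pi_bar2:
  assumes E: "nested_diagram n E" and i: "1 \<le> i" "i \<notin> col E j" "Suc i \<in> col E j"
    and G: "realizes n (swap_rows i E) G"
  shows "realizes n E (pi_bar2 i l G)"
proof -
  have asc: "ascent n (row_size E) i" using nested_rows_ascent assms by blast
  then have range: "i < n" by (simp add: ascent_def)
  let ?c = "col_count E"
  from G obtain d g p where G': "starts_with d G g" "transforms_to n ?c g p"
      "seed_orbit n ?c (complement_rows n (swap_rows i E)) p"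
    unfolding realizes_def col_count_swap_rows by blast
  have "complement_rows n (swap_rows i E) = swap_at (complement_rows n E) (n - i)"
  proof
    fix a
    show "complement_rows n (swap_rows i E) a = swap_at (complement_rows n E) (n - i) a"
    proof (cases "a \<in> {1..n}")
      case True
      have "transpose (n - i) (Suc (n - i)) a \<in> {1..n}"
        "transpose i (Suc i) (n + 1 - a) = n + 1 - transpose (n - i) (Suc (n - i)) a"
        using True range i(1) by (auto simp: transpose_def)
      then show ?thesis
        using True by (simp add: complement_rows_def col_count_swap_rows row_size_swap_rows)
    next
      case False
      then have "transpose (n - i) (Suc (n - i)) a = a"
        using range i(1) by (auto simp: transpose_def)
      then show ?thesis using False by (auto simp: complement_rows_def)
    qed
  qed
  moreover have "ascent n (complement_rows n E) (n - i)"
  proof -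
    have "row_size E i < row_size E (Suc i)" "row_size E (Suc i) \<le> ?c"
      using asc E row_size_le_col_count by (auto simp: ascent_def nested_diagram_def)
    then show ?thesis
      using range i(1) by (auto simp: ascent_def complement_rows_def Suc_diff_le)
  qed
  ultimately have "seed_orbit n ?c (complement_rows n E) (pi_bar (n - i) p)"
    using G'(3) by (intro seed_orbit.ascent) simp_all
  then show ?thesis
    unfolding realizes_def
    using starts_with_pi_bar2[OF G'(1)] transforms_to_ddiff[OF G'(2) i(1) range] by blast
qed

lemma seed_orbit_column_factor_power:
  assumes "seed_orbit n m \<gamma> p" "k \<le> n"
    and "r > 0 \<Longrightarrow> \<forall>a\<in>{1..k}. \<forall>b\<in>{k<..n}. \<gamma> b \<le> \<gamma> a"
  shows "seed_orbit n (m + r) (\<lambda>a. if a \<in> {1..k} then \<gamma> a + r else \<gamma> a) (column_factor n k ^ r * p)"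
  using assms(3)
proof (induction r)
  case (Suc r)
  let ?\<gamma> = "\<lambda>r a. if a \<in> {1..k} then \<gamma> a + r else \<gamma> a"
  have "seed_orbit n (m + r) (?\<gamma> r) (column_factor n k ^ r * p)"
    using Suc by blast
  then have "seed_orbit n (Suc (m + r)) (add_prefix k (?\<gamma> r)) (column_factor n k * (column_factor n k ^ r * p))"
    by (rule seed_orbit_column_factor[OF _ assms(2)]) (use Suc.prems in \<open>auto intro: trans_le_add1\<close>)
  moreover have "add_prefix k (?\<gamma> r) = ?\<gamma> (Suc r)"
    by (auto simp: add_prefix_def fun_eq_iff)
  ultimately show ?case by (simp add: mult.assoc)
qed (use assms(1) in \<open>simp cong: if_cong\<close>)

text \<open>
  In a nested diagram with a column $[i]$, every other column is contained in $[i]$ or contains it,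
  so each of the first \<open>i\<close> rows is at least as large as each later one. If the columns $[i]$ are removed, this
  remains true, and it is the condition under which $P_{n-i}$ can be absorbed into the seed.
\<close>

lemma realizes_omega_bar:
  assumes E: "nested_diagram n E" and i: "1 \<le> i" "i \<le> n"
    and G: "realizes n (empty_cols (interval_cols i E) E) G"
  shows "realizes n E (omega_bar i (interval_cols i E) * G)"
proof -
  define J where "J = interval_cols i E"
  define E' where "E' = empty_cols J E"
  let ?c = "col_count E'" and ?r = "card J" and ?k = "n - i"
  have E': "nested_diagram n E'" unfolding E'_def by (rule nested_diagram_empty_cols[OF E])
  have fin: "finite E" "finite E'" using E E' by (simp_all add: nested_diagram_def)
  have J: "col E j = {1..i}" if "j \<in> J" for j using that by (simp add: J_def interval_cols_def)
  have finJ: "finite J"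
    by (rule finite_subset[OF _ finite_nonempty_cols[OF fin(1)]]) (use J i in auto)
  have cols: "{j. col E j \<noteq> {}} = {j. col E' j \<noteq> {}} \<union> J"
    using J i by (auto simp: E'_def col_empty_cols)
  have c: "col_count E = ?c + ?r"
    unfolding col_count_def cols using finJ finite_nonempty_cols[OF fin(2)]
    by (subst card_Un_disjoint) (auto simp: E'_def col_empty_cols)
  have rows: "row_size E b = row_size E' b + (if b \<in> {1..i} then ?r else 0)" for b
  proof -
    have "b \<in> col E j \<longleftrightarrow> b \<in> {1..i}" if "j \<in> J" for j
      by (simp only: J[OF that])
    then have "(b, j) \<in> E \<longleftrightarrow> (b, j) \<in> E' \<or> j \<in> (if b \<in> {1..i} then J else {})" for j
      by (cases "j \<in> J") (auto simp: E'_def empty_cols_def col_def)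
    then have "{j. (b, j) \<in> E} = {j. (b, j) \<in> E'} \<union> (if b \<in> {1..i} then J else {})"
      by blast
    moreover have "{j. (b, j) \<in> E'} \<inter> (if b \<in> {1..i} then J else {}) = {}"
      by (auto simp: E'_def empty_cols_def)
    ultimately show ?thesis
      unfolding row_size_def using finJ finite_row[OF fin(2), of b]
      by (auto simp: card_Un_disjoint)
  qed
  from G obtain d g p where G': "starts_with d G g" "transforms_to n ?c g p"
      "seed_orbit n ?c (complement_rows n E') p"
    unfolding realizes_def J_def[symmetric] E'_def[symmetric] by blast
  obtain e where 1: "starts_with e (omega_bar i J * G) ((\<Prod>a\<in>{1..i}. \<Prod>m\<in>J. xv a + yv (int m)) * g)"
    using starts_with_omega_bar[OF finJ G'(1)] by blast
  have 2: "transforms_to n (col_count E) ((\<Prod>a\<in>{1..i}. \<Prod>m\<in>J. xv a + yv (int m)) * g)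
      (column_factor n ?k ^ ?r * p)"
    unfolding c by (rule transforms_to_omega[OF G'(2) i(2)])
  have "seed_orbit n (?c + ?r) (\<lambda>a. if a \<in> {1..?k} then complement_rows n E' a + ?r else complement_rows n E' a)
      (column_factor n ?k ^ ?r * p)"
  proof (rule seed_orbit_column_factor_power[OF G'(3)])
    assume "?r > 0"
    then obtain j0 where j0: "j0 \<in> J" by (metis card.empty ex_in_conv less_irrefl)
    show "\<forall>a\<in>{1..?k}. \<forall>b\<in>{?k<..n}. complement_rows n E' b \<le> complement_rows n E' a"
    proof (intro ballI)
      fix a b assume ab: "a \<in> {1..?k}" "b \<in> {?k<..n}"
      have "{j. (n + 1 - a, j) \<in> E'} \<subseteq> {j. (n + 1 - b, j) \<in> E'}"
      proof
        fix j assume j: "j \<in> {j. (n + 1 - a, j) \<in> E'}"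
        then have "n + 1 - a \<in> col E j" by (simp add: E'_def empty_cols_def col_def)
        moreover have "n + 1 - a \<notin> col E j0" using J[OF j0] ab by auto
        ultimately have "col E j0 \<subseteq> col E j" using E unfolding nested_diagram_def by blast
        moreover have "n + 1 - b \<in> col E j0" using J[OF j0] ab i by auto
        ultimately show "j \<in> {j. (n + 1 - b, j) \<in> E'}" using j by (auto simp: E'_def empty_cols_def col_def)
      qed
      then have "row_size E' (n + 1 - a) \<le> row_size E' (n + 1 - b)"
        unfolding row_size_def by (intro card_mono finite_row fin)
      then show "complement_rows n E' b \<le> complement_rows n E' a"
        using ab by (auto simp: complement_rows_def)
    qed
  qed simp
  also have "(\<lambda>a. if a \<in> {1..?k} then complement_rows n E' a + ?r else complement_rows n E' a) =
      complement_rows n E"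
  proof
    fix a
    show "(if a \<in> {1..?k} then complement_rows n E' a + ?r else complement_rows n E' a) = complement_rows n E a"
    proof (cases "a \<in> {1..n}")
      case a: True
      have E_a: "complement_rows n E a = ?c + ?r - (row_size E' (n + 1 - a) + (if n + 1 - a \<in> {1..i} then ?r else 0))"
        and E'_a: "complement_rows n E' a = ?c - row_size E' (n + 1 - a)"
        unfolding complement_rows_def c rows using a by simp_all
      have le: "row_size E' (n + 1 - a) \<le> ?c" by (rule row_size_le_col_count[OF fin(2)])
      show ?thesis
      proof (cases "a \<in> {1..?k}")
        case True
        then have "complement_rows n E a = ?c + ?r - row_size E' (n + 1 - a)"
          unfolding E_a by auto
        then show ?thesis unfolding E'_a using True le by simp
      next
        case False
        then have "n + 1 - a \<in> {1..i}" using a i by auto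
        then show ?thesis unfolding E_a E'_a using False by auto
      qed
    next
      case False
      then have "a \<notin> {1..?k}" by auto
      then show ?thesis using False by (auto simp: complement_rows_def)
    qed
  qed
  finally have 3: "seed_orbit n (col_count E) (complement_rows n E) (column_factor n ?k ^ ?r * p)"
    unfolding c .
  show ?thesis
    using 1 2 3 unfolding realizes_def J_def by blast
qed

section \<open>The orthodontic sequence\<close>

text \<open>
  The diagrams that occur between two steps: a nonempty column without missing teeth would be some
  $[k]$, and these have been removed.
\<close>

definition orthodontic :: "nat \<Rightarrow> diagram \<Rightarrow> bool" where
  "orthodontic n E \<longleftrightarrow> nested_diagram n E \<and> (\<forall>i\<in>{1..n}. interval_cols i E = {})"

lemma missing_tooth_exists:
  assumes "C \<subseteq> {1..n}" "C \<noteq> {}" "\<And>k. k \<in> {1..n} \<Longrightarrow> C \<noteq> {1..k}"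
  shows "\<exists>i. missing_tooth C i"
proof (rule ccontr)
  assume none: "\<nexists>i. missing_tooth C i"
  have fin: "finite C" using assms(1) by (rule finite_subset) simp
  define k where "k = Max C"
  have k: "k \<in> C" unfolding k_def using fin assms(2) by (rule Max_in)
  have "b \<in> C" if "1 \<le> b" "b \<le> k" for b
    using that(2,1)
  proof (induction b rule: inc_induct)
    case (step c)
    then show ?case using none by (auto simp: missing_tooth_def)
  qed (rule k)
  moreover have "b \<le> k" if "b \<in> C" for b unfolding k_def using fin that by (rule Max_ge)
  moreover have "1 \<le> b" if "b \<in> C" for b using that assms(1) by auto
  ultimately have "b \<in> C \<longleftrightarrow> b \<in> {1..k}" for b by (meson atLeastAtMost_iff)
  then have "C = {1..k}" by blast
  then show False using assms(1,3) k by blast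
qed

lemma missing_tooth_tooth:
  assumes "orthodontic n E" "E \<noteq> {}"
  shows "missing_tooth (col E (first_col E)) (tooth E)"
proof -
  let ?C = "col E (first_col E)"
  have "\<exists>j. col E j \<noteq> {}" using assms(2) by (force simp: col_def)
  then have "?C \<noteq> {}" unfolding first_col_def by (rule LeastI_ex)
  moreover have "?C \<subseteq> {1..n}" using assms(1) by (auto simp: orthodontic_def nested_diagram_def col_def)
  moreover have "?C \<noteq> {1..k}" if "k \<in> {1..n}" for k
    using assms(1) that by (auto simp: orthodontic_def interval_cols_def)
  ultimately have "\<exists>i. missing_tooth ?C i" by (intro missing_tooth_exists)
  then show ?thesis unfolding tooth_def by (rule LeastI_ex)
qed

lemma tooth_ascent:
  assumes "orthodontic n E" "E \<noteq> {}"
  shows "ascent n (row_size E) (tooth E)"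
  using missing_tooth_tooth[OF assms] assms(1) nested_rows_ascent
  unfolding missing_tooth_def orthodontic_def by blast

text \<open>
  Exchanging rows \<open>i\<close> and $i + 1$ fixes $[k]$ unless $k = i$, so the only new columns of the form $[k]$
  are the columns $[i]$ that the step removes.
\<close>

lemma orthodontic_ortho_step:
  assumes "orthodontic n E" "E \<noteq> {}"
  shows "orthodontic n (ortho_step E)"
proof -
  let ?i = "tooth E"
  have i: "1 \<le> ?i" "?i < n" using tooth_ascent[OF assms] by (simp_all add: ascent_def)
  have "nested_diagram n (ortho_step E)"
    unfolding ortho_step_def using assms(1) i
    by (intro nested_diagram_empty_cols nested_diagram_swap_rows) (simp_all add: orthodontic_def)
  moreover have "interval_cols k (ortho_step E) = {}" if k: "k \<in> {1..n}" for k
  proof (rule ccontr)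
    assume "interval_cols k (ortho_step E) \<noteq> {}"
    then obtain j where "col (ortho_step E) j = {1..k}" by (auto simp: interval_cols_def)
    then have j: "j \<notin> tooth_cols E" "col (swap_rows ?i E) j = {1..k}"
      using k unfolding ortho_step_def col_empty_cols by (auto split: if_splits)
    then have "k \<noteq> ?i" by (auto simp: tooth_cols_def interval_cols_def)
    have "col E j = transpose ?i (Suc ?i) ` col (swap_rows ?i E) j"
      unfolding col_swap_rows image_image by simp
    also have "\<dots> = {1..k}"
      unfolding j(2)
    proof (rule bij_betw_imp_surj_on[OF bij_betwI[where g = "transpose ?i (Suc ?i)"]])
      show "transpose ?i (Suc ?i) \<in> {1..k} \<rightarrow> {1..k}" "transpose ?i (Suc ?i) \<in> {1..k} \<rightarrow> {1..k}"
        using \<open>k \<noteq> ?i\<close> i(1) by (auto simp: transpose_def)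
    qed simp_all
    finally show False using assms(1) k by (auto simp: orthodontic_def interval_cols_def)
  qed
  ultimately show ?thesis by (simp add: orthodontic_def)
qed

text \<open>
  The step moves boxes upwards: it exchanges a row with a larger row below it and then deletes boxes.
\<close>

lemma ortho_step_weight_less:
  assumes "orthodontic n E" "E \<noteq> {}"
  shows "(\<Sum>b\<in>{1..n}. b * row_size (ortho_step E) b) < (\<Sum>b\<in>{1..n}. b * row_size E b)"
proof -
  have "row_size (ortho_step E) b \<le> row_size (swap_rows (tooth E) E) b" for b
  proof -
    have "finite (swap_rows (tooth E) E)"
      using assms(1) by (simp add: orthodontic_def nested_diagram_def swap_rows_def)
    then show ?thesis
      unfolding row_size_def ortho_step_def
      by (intro card_mono finite_row) (auto simp: empty_cols_def)
  qed
  then have "(\<Sum>b\<in>{1..n}. b * row_size (ortho_step E) b) \<le>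
      (\<Sum>b\<in>{1..n}. b * row_size (swap_rows (tooth E) E) b)"
    by (intro sum_mono mult_left_mono) auto
  also have "\<dots> < (\<Sum>b\<in>{1..n}. b * row_size E b)"
    unfolding row_size_swap_rows by (rule weight_swap_less[OF tooth_ascent[OF assms]])
  finally show ?thesis .
qed

lemma ortho_step_terminates:
  assumes "orthodontic n E"
  shows "\<exists>k. (ortho_step ^^ k) E = {}"
  using assms
proof (induction E rule: measure_induct_rule[of "\<lambda>E. \<Sum>b\<in>{1..n}. b * row_size E b"])
  case (less E)
  show ?case
  proof (cases "E = {}")
    case True
    then have "(ortho_step ^^ 0) E = {}" by simp
    then show ?thesis ..
  next
    case False
    then obtain k where "(ortho_step ^^ k) (ortho_step E) = {}"
      using less.IH ortho_step_weight_less[OF less.prems] orthodontic_ortho_step[OF less.prems] by blast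
    then have "(ortho_step ^^ Suc k) E = {}" by (simp add: funpow_swap1)
    then show ?thesis ..
  qed
qed

lemma orthodontic_ortho_start:
  assumes "nested_diagram n D"
  shows "orthodontic n (ortho_start n D)"
proof -
  have "interval_cols i (ortho_start n D) = {}" if "i \<in> {1..n}" for i
  proof (rule ccontr)
    assume "interval_cols i (ortho_start n D) \<noteq> {}"
    then obtain j where j: "col (ortho_start n D) j = {1..i}" by (auto simp: interval_cols_def)
    then have "col D j = {1..i}" "j \<notin> interval_cols i D"
      using that unfolding ortho_start_def col_empty_cols by (auto split: if_splits)
    then show False by (simp add: interval_cols_def)
  qed
  then show ?thesis
    unfolding orthodontic_def using nested_diagram_empty_cols[OF assms] by (simp add: ortho_start_def)
qed

text \<open>
  The nested operators are evaluated from the inside, so the induction runs backwards from the empty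
  diagram that ends the orthodontic sequence.
\<close>

lemma realizes_ortho_start:
  assumes "nested_diagram n D"
  shows "realizes n (ortho_start n D)
    (foldr (\<lambda>k f. let E = ortho_diagram n D k
        in pi_bar2 (tooth E) (tooth_index E) (omega_bar (tooth E) (tooth_cols E) * f))
      [0..<ortho_length n D] 1)"
proof -
  define F where "F = (\<lambda>k f. let E = ortho_diagram n D k
    in pi_bar2 (tooth E) (tooth_index E) (omega_bar (tooth E) (tooth_cols E) * f))"
  let ?E = "ortho_diagram n D" and ?l = "ortho_length n D"
  have "\<exists>k. ?E k = {}"
    unfolding ortho_diagram_def by (rule ortho_step_terminates[OF orthodontic_ortho_start[OF assms]])
  then have last: "?E ?l = {}" unfolding ortho_length_def by (rule LeastI_ex)
  have nonempty: "?E k \<noteq> {}" if "k < ?l" for k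
    using that not_less_Least unfolding ortho_length_def by blast
  have step: "?E (Suc k) = ortho_step (?E k)" for k
    by (simp add: ortho_diagram_def)
  have orth: "orthodontic n (?E k)" if "k \<le> ?l" for k
    using that
  proof (induction k)
    case 0
    show ?case using orthodontic_ortho_start[OF assms] by (simp add: ortho_diagram_def)
  next
    case (Suc k)
    then show ?case using orthodontic_ortho_step nonempty by (simp add: step)
  qed
  have "realizes n (?E k) (foldr F [k..<?l] 1)" if "k \<le> ?l" for k
    using that
  proof (induction k rule: inc_induct)
    case base
    show ?case using last realizes_empty by simp
  next
    case (step k)
    let ?i = "tooth (?E k)"
    have k: "orthodontic n (?E k)" "?E k \<noteq> {}" using orth nonempty step.hyps by simp_all
    then have nested: "nested_diagram n (?E k)" by (simp add: orthodontic_def)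
    have tooth: "1 \<le> ?i" "?i \<notin> col (?E k) (first_col (?E k))" "Suc ?i \<in> col (?E k) (first_col (?E k))"
      using missing_tooth_tooth[OF k] by (simp_all add: missing_tooth_def)
    have "?i < n" using tooth_ascent[OF k] by (simp add: ascent_def)
    then have nested': "nested_diagram n (swap_rows ?i (?E k))"
      using nested tooth(1) by (intro nested_diagram_swap_rows)
    have "realizes n (empty_cols (interval_cols ?i (swap_rows ?i (?E k))) (swap_rows ?i (?E k)))
        (foldr F [Suc k..<?l] 1)"
      using step.IH by (simp add: \<open>?E (Suc k) = ortho_step (?E k)\<close> ortho_step_def tooth_cols_def)
    then have "realizes n (swap_rows ?i (?E k)) (omega_bar ?i (tooth_cols (?E k)) * foldr F [Suc k..<?l] 1)"
      unfolding tooth_cols_def using \<open>?i < n\<close> by (intro realizes_omega_bar nested' tooth(1)) simp_all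
    then have "realizes n (?E k) (F k (foldr F [Suc k..<?l] 1))"
      unfolding F_def Let_def by (rule realizes_pi_bar2[OF nested tooth])
    then show ?case using step.hyps by (simp add: upt_conv_Cons)
  qed
  from this[of 0] show ?thesis by (simp add: ortho_diagram_def F_def)
qed

text \<open>
  The columns $[i]$ of the diagram itself are put back one \<open>i\<close> at a time, in the order $n, \ldots, 1$.
\<close>

lemma realizes_double_G:
  assumes "nested_diagram n D"
  shows "realizes n D (double_G n D)"
proof -
  define G where "G = foldr (\<lambda>k f. let E = ortho_diagram n D k
        in pi_bar2 (tooth E) (tooth_index E) (omega_bar (tooth E) (tooth_cols E) * f))
      [0..<ortho_length n D] 1"
  define E where "E t = empty_cols (\<Union>i\<in>{1..t}. interval_cols i D) D" for t
  have "realizes n (E t) ((\<Prod>i\<in>{t<..n}. omega_bar i (interval_cols i D)) * G)" if "t \<le> n" for t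
    using that
  proof (induction t rule: inc_induct)
    case base
    show ?case using realizes_ortho_start[OF assms] by (simp add: E_def ortho_start_def G_def)
  next
    case (step t)
    have cols: "col (E s) j = (if \<exists>i\<in>{1..s}. col D j = {1..i} then {} else col D j)" for s j
      by (auto simp: E_def col_empty_cols interval_cols_def)
    have "interval_cols (Suc t) (E t) = interval_cols (Suc t) D"
      unfolding interval_cols_def cols by auto
    moreover have "empty_cols (interval_cols (Suc t) D) (E t) = E (Suc t)"
      by (auto simp: E_def empty_cols_def atLeastAtMostSuc_conv)
    ultimately have "realizes n (E t) (omega_bar (Suc t) (interval_cols (Suc t) D) *
        ((\<Prod>i\<in>{Suc t<..n}. omega_bar i (interval_cols i D)) * G))"
      using realizes_omega_bar[of n "E t" "Suc t"] nested_diagram_empty_cols[OF assms] step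
      by (simp add: E_def)
    moreover have "{t<..n} = insert (Suc t) {Suc t<..n}" using step.hyps by auto
    ultimately show ?case by (simp add: mult.assoc)
  qed
  from this[of 0] show ?thesis
    by (simp add: E_def empty_cols_def double_G_def G_def atLeastSucAtMost_greaterThanAtMost)
qed

text \<open>
  The inductive description may use a composition repeatedly; collecting terms gives the coefficients.
\<close>

lemma graded_cone_finite_sum:
  assumes "graded_cone n S p"
  shows "\<exists>A c. finite A \<and> A \<subseteq> S \<and> (\<forall>\<alpha>\<in>A. 0 \<le> (c \<alpha> :: int)) \<and>
    p = (\<Sum>\<alpha>\<in>A. (-1) ^ size_comp n \<alpha> * of_int (c \<alpha>) * lascoux n \<alpha>)"
  using assms
proof induction
  case zero
  show ?case by (intro exI[of _ "{}"]) simp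
next
  case (step p \<alpha>)
  then obtain A c where A: "finite A" "A \<subseteq> S" "\<forall>\<alpha>\<in>A. 0 \<le> (c \<alpha> :: int)"
    and p: "p = (\<Sum>\<alpha>\<in>A. (-1) ^ size_comp n \<alpha> * of_int (c \<alpha>) * lascoux n \<alpha>)" by blast
  let ?f = "\<lambda>\<alpha>. (-1) ^ size_comp n \<alpha> * lascoux n \<alpha>"
  define c' where "c' \<beta> = (if \<beta> \<in> A then c \<beta> else 0) + (if \<beta> = \<alpha> then 1 else 0)" for \<beta>
  have "(\<Sum>\<beta>\<in>insert \<alpha> A. (-1) ^ size_comp n \<beta> * of_int (c' \<beta>) * lascoux n \<beta>) =
      (\<Sum>\<beta>\<in>insert \<alpha> A. if \<beta> \<in> A then (-1) ^ size_comp n \<beta> * of_int (c \<beta>) * lascoux n \<beta> else 0) +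
      (\<Sum>\<beta>\<in>insert \<alpha> A. if \<beta> = \<alpha> then ?f \<beta> else 0)"
    unfolding sum.distrib[symmetric] by (intro sum.cong) (auto simp: c'_def algebra_simps)
  also have "(\<Sum>\<beta>\<in>insert \<alpha> A. if \<beta> \<in> A then (-1) ^ size_comp n \<beta> * of_int (c \<beta>) * lascoux n \<beta> else 0) = p"
    unfolding p using A(1) by (intro sum.mono_neutral_cong_right) auto
  also have "(\<Sum>\<beta>\<in>insert \<alpha> A. if \<beta> = \<alpha> then ?f \<beta> else 0) = ?f \<alpha>"
    using A(1) by simp
  finally have "p + ?f \<alpha> = (\<Sum>\<beta>\<in>insert \<alpha> A. (-1) ^ size_comp n \<beta> * of_int (c' \<beta>) * lascoux n \<beta>)" ..
  moreover have "\<forall>\<beta>\<in>insert \<alpha> A. 0 \<le> c' \<beta>" using A(3) by (auto simp: c'_def)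
  ultimately show ?case
    using A(1,2) step.hyps(2) by (intro exI[of _ "insert \<alpha> A"] exI[of _ c'] conjI) simp_all
qed

theorem theorem1p2:
  fixes n m :: nat and D :: diagram
  assumes "D \<subseteq> {1..n} \<times> {1..m}"
    and "columns_ordered_by_inclusion m D"
  shows "\<exists>f. to_laurent f =
               (\<Prod>i\<in>{1..n}. to_laurent (xv i) ^ m) * reverse_inverse_spec n (double_S n D)
             \<and> graded_nonneg_lascoux n f"
proof -
  have outside: "col D j = {}" if "j \<notin> {1..m}" for j
    using assms(1) that by (auto simp: col_def)
  have "nested_diagram n D"
    unfolding nested_diagram_def
  proof (intro conjI allI)
    show "finite D" using assms(1) by (rule finite_subset) simp
    show "D \<subseteq> {1..n} \<times> UNIV" using assms(1) by auto
    show "col D j \<subseteq> col D j' \<or> col D j' \<subseteq> col D j" for j j'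
      using assms(2) outside[of j] outside[of j'] unfolding columns_ordered_by_inclusion_def by blast
  qed
  from realizes_double_G[OF this] obtain d g p where g: "starts_with d (double_G n D) g"
      and p: "transforms_to n (col_count D) g p" "seed_orbit n (col_count D) (complement_rows n D) p"
    unfolding realizes_def by blast
  \<comment> \<open>Each of the \<open>r\<close> empty columns contributes $P_n = x_1 \cdots x_n$, like a column $[0]$.\<close>
  have "col_count D \<le> card {1..m}"
    unfolding col_count_def by (intro card_mono) (use outside in auto)
  then obtain r where r: "m = col_count D + r" by (metis card_atLeastAtMost diff_Suc_1 le_iff_add)
  define f where "f = column_factor n n ^ r * p"
  have f: "transforms_to n m g f"
    using transforms_to_omega[OF p(1), of 0 "{..<r}"] by (simp add: r f_def)
  obtain \<gamma> where \<gamma>: "seed_orbit n m \<gamma> f"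
    using seed_orbit_column_factor_power[OF p(2), of n r] by (auto simp: r f_def)
  obtain h where h: "starts_with (size_comp n \<gamma>) f h" "h \<noteq> 0"
    using seed_orbit_lowest_part[OF \<gamma>] by blast
  have "f \<noteq> 0" and low: "low_deg f = size_comp n \<gamma>"
    using lowest_part_starts_with[OF h] by blast+
  have "g \<noteq> 0"
  proof
    assume "g = 0"
    then have "to_laurent f = 0" using f by (simp add: transforms_to_def spec.map_zero)
    then show False using to_laurent_eq_0D \<open>f \<noteq> 0\<close> by blast
  qed
  then have S: "double_S n D = g"
    unfolding double_S_def using lowest_part_starts_with[OF g] by blast
  obtain A c where A: "finite A" "A \<subseteq> compositions n" "\<forall>\<alpha>\<in>A. 0 \<le> (c \<alpha> :: int)"
    and sum: "(-1) ^ size_comp n \<gamma> * f = (\<Sum>\<alpha>\<in>A. (-1) ^ size_comp n \<alpha> * of_int (c \<alpha>) * lascoux n \<alpha>)"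
    using graded_cone_finite_sum[OF graded_cone_seed_orbit[OF \<gamma>]] by blast
  have "f = (-1) ^ size_comp n \<gamma> * ((-1) ^ size_comp n \<gamma> * f)"
    by (simp add: mult.assoc[symmetric] power_add[symmetric])
  also have "\<dots> = (\<Sum>\<alpha>\<in>A. (-1) ^ (size_comp n \<alpha> + low_deg f) * of_int (c \<alpha>) * lascoux n \<alpha>)"
    unfolding sum low by (simp add: sum_distrib_left power_add ac_simps)
  finally have "graded_nonneg_lascoux n f"
    unfolding graded_nonneg_lascoux_def using A \<open>f \<noteq> 0\<close> by blast
  moreover have "to_laurent f = (\<Prod>i\<in>{1..n}. to_laurent (xv i) ^ m) * reverse_inverse_spec n (double_S n D)"
    using f by (simp add: transforms_to_def S laurent.map_simps prod_power_distrib)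
  ultimately show ?thesis by blast
qed

end
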